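(* Let $n\ge 1$, let $\mathbb{R}^n$ be equipped with a norm $\|\cdot\|$, and let $U\subseteq\mathbb{R}^n$ be a nonempty open convex set with $0\in U$. Let $X$ be the subspace of $L^\infty(U;(\mathbb{R}^n)^* )$ consisting of the Lipschitz-compatible elements. Then the spaces $X$ (with the norm $\|\cdot\|_\infty$) and $Lip_0(U)$ (with the norm $\|\cdot\|_L$) are linearly isometric, i.e. there is a bijective linear isometry between them.
   Context: $(\mathbb{R}^n)^*$ carries the dual norm $\|\cdot\|_*$. $Lip_0(U)$ is the space of Lipschitz functions $f:U\to\mathbb{R}$ with $f(0)=0$, normed by the Lipschitz constant $\|f\|_L=\sup_{x\ne y}\frac{|f(x)-f(y)|}{\|x-y\|}$. $L^\infty(U;(\mathbb{R}^n)^* )$ is the space of (classes of) Lebesgue-measurable essentially bounded functions $g:U\to(\mathbb{R}^n)^*$ with norm $\|g\|_\infty=\operatorname{ess\,sup}_U\|g\|_*$. For $x\in U$ and $g\in L^\infty(U;(\mathbb{R}^n)^* )$, define, as a function of $y\in U$ up to equality almost everywhere, $(T_xg)(y)=\int_0^1\langle g(x+t(y-x)),y-x\rangle\,dt$ for every $y\in U$ such that the integral is well-defined, and $(T_xg)(y)=0$ otherwise. An element $g\in L^\infty(U;(\mathbb{R}^n)^* )$ is called Lipschitz-compatible if $(T_0g)(y)-(T_0g)(x)=(T_xg)(y)$ for almost every $(x,y)\in U\times U$ (with respect to the product Lebesgue measure). *)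

theory Defs
  imports "HOL-Probability.Essential_Supremum"
begin

text \<open>The norm of the type class on \<^typ>\<open>real ^ 'n\<close> is the Euclidean one. An arbitrary norm
  on the space is therefore a function \<open>N\<close> satisfying the norm axioms. The dual space is the type
  of bounded linear functionals; every linear functional is bounded because the dimension is finite,
  but the operator norm of that type is the Euclidean one, so \<open>dual_norm\<close> is defined from \<open>N\<close>.\<close>

definition is_norm :: "(real ^ 'n \<Rightarrow> real) \<Rightarrow> bool" where
  "is_norm N \<longleftrightarrow>
     (\<forall>x. N x \<ge> 0) \<and> (\<forall>x. N x = 0 \<longleftrightarrow> x = 0) \<and>
     (\<forall>c x. N (c *\<^sub>R x) = \<bar>c\<bar> * N x) \<and>
     (\<forall>x y. N (x + y) \<le> N x + N y)"

type_synonym 'n dual = "(real ^ 'n) \<Rightarrow>\<^sub>L real"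

definition dual_norm :: "(real ^ 'n \<Rightarrow> real) \<Rightarrow> 'n dual \<Rightarrow> real" where
  "dual_norm N \<phi> = (SUP v\<in>{v. N v \<le> 1}. \<bar>blinfun_apply \<phi> v\<bar>)"

record 'v normed_space =
  vectors :: "'v set"
  vadd :: "'v \<Rightarrow> 'v \<Rightarrow> 'v"
  vscale :: "real \<Rightarrow> 'v \<Rightarrow> 'v"
  vnorm :: "'v \<Rightarrow> real"

text \<open>Linearity includes closure of the domain under the vector space operations, so that \<open>\<Phi>\<close> is
  only ever evaluated inside the domain.\<close>

definition linearly_isometric :: "'v normed_space \<Rightarrow> 'w normed_space \<Rightarrow> bool" where
  "linearly_isometric V W \<longleftrightarrow>
     (\<exists>\<Phi>. bij_betw \<Phi> (vectors V) (vectors W) \<and>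
        (\<forall>u\<in>vectors V. \<forall>v\<in>vectors V.
            vadd V u v \<in> vectors V \<and> \<Phi> (vadd V u v) = vadd W (\<Phi> u) (\<Phi> v)) \<and>
        (\<forall>c. \<forall>u\<in>vectors V.
            vscale V c u \<in> vectors V \<and> \<Phi> (vscale V c u) = vscale W c (\<Phi> u)) \<and>
        (\<forall>u\<in>vectors V. vnorm W (\<Phi> u) = vnorm V u))"

text \<open>A function on \<open>U\<close> is represented by its extensional total function.\<close>

definition Lip0_vectors :: "(real ^ 'n \<Rightarrow> real) \<Rightarrow> (real ^ 'n) set \<Rightarrow> (real ^ 'n \<Rightarrow> real) set" where
  "Lip0_vectors N U =
     {f \<in> extensional U. f 0 = 0 \<and> (\<exists>L. \<forall>x\<in>U. \<forall>y\<in>U. \<bar>f x - f y\<bar> \<le> L * N (x - y))}"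

definition lip_norm :: "(real ^ 'n \<Rightarrow> real) \<Rightarrow> (real ^ 'n) set \<Rightarrow> (real ^ 'n \<Rightarrow> real) \<Rightarrow> real" where
  "lip_norm N U f = (SUP (x, y)\<in>{(x, y). x \<in> U \<and> y \<in> U \<and> x \<noteq> y}. \<bar>f x - f y\<bar> / N (x - y))"

definition Lip0 ::
  "(real ^ 'n \<Rightarrow> real) \<Rightarrow> (real ^ 'n) set \<Rightarrow> (real ^ 'n \<Rightarrow> real) normed_space" where
  "Lip0 N U =
     \<lparr> vectors = Lip0_vectors N U,
       vadd = (\<lambda>f g. \<lambda>x\<in>U. f x + g x),
       vscale = (\<lambda>c f. \<lambda>x\<in>U. c * f x),
       vnorm = lip_norm N U \<rparr>"

text \<open>Representatives are total functions; their values outside \<open>U\<close> are irrelevant, as they are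
  identified by the quotient.\<close>

definition Linf_fun :: "(real ^ 'n \<Rightarrow> real) \<Rightarrow> (real ^ 'n) set \<Rightarrow> (real ^ 'n \<Rightarrow> 'n dual) set" where
  "Linf_fun N U =
     {g \<in> borel_measurable (lebesgue_on U). \<exists>C. AE x in lebesgue_on U. dual_norm N (g x) \<le> C}"

definition Linf_rel ::
  "(real ^ 'n \<Rightarrow> real) \<Rightarrow> (real ^ 'n) set \<Rightarrow>
     ((real ^ 'n \<Rightarrow> 'n dual) \<times> (real ^ 'n \<Rightarrow> 'n dual)) set" where
  "Linf_rel N U =
     {(g, h). g \<in> Linf_fun N U \<and> h \<in> Linf_fun N U \<and> (AE x in lebesgue_on U. g x = h x)}"

text \<open>The essential supremum is the same for all representatives of a class, so
  \<open>the_elem\<close> picks their common value.\<close>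

definition Linf ::
  "(real ^ 'n \<Rightarrow> real) \<Rightarrow> (real ^ 'n) set \<Rightarrow> (real ^ 'n \<Rightarrow> 'n dual) set normed_space" where
  "Linf N U =
     \<lparr> vectors = Linf_fun N U // Linf_rel N U,
       vadd = (\<lambda>G H. \<Union>g\<in>G. \<Union>h\<in>H. Linf_rel N U `` {\<lambda>x. g x + h x}),
       vscale = (\<lambda>c G. \<Union>g\<in>G. Linf_rel N U `` {\<lambda>x. c *\<^sub>R g x}),
       vnorm = (\<lambda>G. real_of_ereal
          (the_elem ((\<lambda>g. esssup (lebesgue_on U) (\<lambda>x. ereal (dual_norm N (g x)))) ` G))) \<rparr>"

definition T_op :: "real ^ 'n \<Rightarrow> (real ^ 'n \<Rightarrow> 'n dual) \<Rightarrow> real ^ 'n \<Rightarrow> real" where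
  "T_op x g y =
     (let F = (\<lambda>t. blinfun_apply (g (x + t *\<^sub>R (y - x))) (y - x))
      in if integrable (lebesgue_on {0..1}) F then integral\<^sup>L (lebesgue_on {0..1}) F else 0)"

definition lipschitz_compatible :: "(real ^ 'n) set \<Rightarrow> (real ^ 'n \<Rightarrow> 'n dual) \<Rightarrow> bool" where
  "lipschitz_compatible U g \<longleftrightarrow>
     (AE (x, y) in lebesgue_on U \<Otimes>\<^sub>M lebesgue_on U. T_op 0 g y - T_op 0 g x = T_op x g y)"

text \<open>Compatibility does not depend on the representative: for a null set \<open>Z\<close> and almost every
  \<open>(x, y)\<close>, the point \<open>x + t (y - x)\<close> lies outside \<open>Z\<close> for almost every \<open>t\<close>.\<close>

definition Linf_compatible ::
  "(real ^ 'n \<Rightarrow> real) \<Rightarrow> (real ^ 'n) set \<Rightarrow> (real ^ 'n \<Rightarrow> 'n dual) set normed_space" where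
  "Linf_compatible N U =
     (Linf N U)\<lparr> vectors := {G \<in> vectors (Linf N U). \<forall>g\<in>G. lipschitz_compatible U g} \<rparr>"

end

theory Submission
  imports Defs
begin

text \<open>A Lipschitz function \<open>f\<close> with \<open>f 0 = 0\<close> corresponds to its gradient. By Rademacher's theorem the
  gradient \<open>\<gamma>\<close> exists almost everywhere, and its dual norm is bounded by the Lipschitz constant;
  since almost every segment from a fixed point meets a null set in a null set of parameters, \<open>f\<close> is
  recovered by integrating \<open>\<gamma>\<close> along segments, which is Lipschitz compatibility. Conversely, for a
  compatible \<open>g\<close> the increments of \<open>T_op 0 g\<close> are segment integrals of \<open>g\<close>, so \<open>T_op 0 g\<close> agrees almost
  everywhere with a Lipschitz function of constant at most the essential supremum of \<open>g\<close>. A bounded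
  field whose integrals along almost all segments vanish is zero almost everywhere, so \<open>g\<close> is the
  gradient of that function; this gives bijectivity and equality of the norms.\<close>

text \<open>An element of the essentially bounded fields has no values on a single segment, which is
  a null set once n >= 2. Every argument therefore treats almost all segments at once, by Fubini.
  Fubini needs measurable exceptional sets and \<open>T_op\<close> has a default value, so classes
  are first replaced by Borel representatives that are bounded everywhere. The base point 0 is a
  null set as well: compatibility, a statement about almost all pairs, gives nothing at
  \<open>x = 0\<close>, although \<open>T_op 0 g\<close> occurs in it. Segment statements are
  therefore proved both for every fixed base point and for almost every pair. Equality of norms
  tolerates no loss of constants. Euclidean Lipschitz constants serve only for existence and
  measurability; all quantitative bounds are in \<open>N\<close>, and extension to the whole space
  keeps the constant. Work proceeds with the relation \<open>is_potential\<close> between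
  representatives. A single statement, \<open>gradient_AE_eq\<close>, carries independence of the
  representative, injectivity and linearity.\<close>

section \<open>Lipschitz functions of one real variable\<close>

text \<open>\<open>F t = \<phi> t + (L + 1) * t\<close> is a bi-Lipschitz bijection of the line, so its inverse pushes
  Lebesgue measure forward to an absolutely continuous measure that gives \<open>{a..b}\<close> the mass
  \<open>F b - F a\<close>; its Radon-Nikodym density is \<open>h + (L + 1)\<close>.\<close>

lemma lipschitz_real_density:
  fixes \<phi> :: "real \<Rightarrow> real"
  assumes lip: "L-lipschitz_on UNIV \<phi>"
  obtains h where "h \<in> borel_measurable borel"
    "\<And>a b. a \<le> b \<Longrightarrow> set_integrable lborel {a..b} h"
    "\<And>a b. a \<le> b \<Longrightarrow> (LINT t:{a..b}|lborel. h t) = \<phi> b - \<phi> a"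
proof -
  have L0: "0 \<le> L" using lip by (rule lipschitz_on_nonneg)
  have lip': "\<bar>\<phi> x - \<phi> y\<bar> \<le> L * \<bar>x - y\<bar>" for x y
    using lipschitz_onD[OF lip, of x y] by (simp add: dist_real_def)
  \<comment> \<open>Slope \<open>L + 1\<close> rather than \<open>L\<close> makes each increment of
    \<open>F\<close> at least the increment of its argument, so the inverse of \<open>F\<close>
    exists.\<close>
  define F where "F t = \<phi> t + (L + 1) * t" for t
  have F_lower: "b - a \<le> F b - F a" if "a \<le> b" for a b
    using lip'[of b a] that by (simp add: F_def algebra_simps abs_le_iff)
  have F_upper: "\<bar>F b - F a\<bar> \<le> (2 * L + 1) * \<bar>b - a\<bar>" for a b
  proof -
    have "\<bar>F b - F a\<bar> \<le> \<bar>\<phi> b - \<phi> a\<bar> + \<bar>(L + 1) * (b - a)\<bar>"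
      by (simp add: F_def algebra_simps)
    also have "\<bar>(L + 1) * (b - a)\<bar> = (L + 1) * \<bar>b - a\<bar>" using L0 by (simp add: abs_mult)
    finally show ?thesis using lip'[of b a] by (simp add: algebra_simps)
  qed
  have F_le_iff: "F a \<le> F b \<longleftrightarrow> a \<le> b" for a b
    using F_lower[of a b] F_lower[of b a] by linarith
  have "continuous_on UNIV \<phi>" using lip by (rule lipschitz_on_continuous_on)
  then have F_cont: "continuous_on A F" for A
    unfolding F_def by (auto intro!: continuous_intros intro: continuous_on_subset)
  have "\<exists>t. F t = y" for y
  proof -
    \<comment> \<open>\<open>F\<close> grows at least as fast as its argument, so walking the
      distance \<open>d\<close> from 0 to either side passes the value \<open>y\<close>.\<close>
    define d where "d = \<bar>y - F 0\<bar>"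
    have d: "0 \<le> d" "y - F 0 \<le> d" "F 0 - y \<le> d" by (auto simp: d_def)
    then have "F (- d) \<le> y" "y \<le> F d" using F_lower[of "- d" 0] F_lower[of 0 d] by simp_all
    then show ?thesis using IVT'[of F "- d" y d] F_cont[of "{- d..d}"] \<open>0 \<le> d\<close> by auto
  qed
  then obtain G where FG: "F (G y) = y" for y by metis
  have GF: "G (F t) = t" for t using FG[of "F t"] F_le_iff by (metis antisym order_refl)
  have "mono G" by (intro monoI) (metis FG F_le_iff)
  then have G_meas[measurable]: "G \<in> borel_measurable borel" by (rule borel_measurable_mono)
  have vimage: "G -` A = F ` A" for A by (auto simp: GF image_iff) (metis FG)
  let ?M = "distr lborel borel G"
  have "absolutely_continuous lborel ?M"
    unfolding absolutely_continuous_def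
  proof
    fix A :: "real set" assume A: "A \<in> null_sets lborel"
    then have [measurable]: "A \<in> sets borel" and "negligible A"
      by (auto simp: negligible_iff_null_sets null_sets_completionI)
    \<comment> \<open>Absolute continuity: preimages under \<open>G\<close> are images under
      \<open>F\<close>, and a Lipschitz map of the line sends null sets to null sets.\<close>
    have "negligible (F ` A)"
    proof (rule negligible_locally_Lipschitz_image[OF _ \<open>negligible A\<close>])
      fix x assume "x \<in> A"
      show "\<exists>T B. open T \<and> x \<in> T \<and> (\<forall>y\<in>A \<inter> T. norm (F y - F x) \<le> B * norm (y - x))"
        using F_upper by (intro exI[of _ UNIV] exI[of _ "2 * L + 1"]) auto
    qed simp
    then have "G -` A \<in> null_sets lebesgue" by (simp add: vimage negligible_iff_null_sets)
    moreover have "G -` A \<in> sets borel" using measurable_sets_borel[OF G_meas] by simp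
    ultimately have "emeasure lborel (G -` A) = 0"
      by (simp add: null_sets_def)
    then show "A \<in> null_sets ?M" by (simp add: null_sets_def emeasure_distr)
  qed
  then obtain f where f[measurable]: "f \<in> borel_measurable borel" and fM: "density lborel f = ?M"
    using sigma_finite_measure.Radon_Nikodym[OF sigma_finite_lborel, of ?M] by auto
  have nn: "(\<integral>\<^sup>+t. f t * indicator {a..b} t \<partial>lborel) = ennreal (F b - F a)" if "a \<le> b" for a b
  proof -
    have "(\<integral>\<^sup>+t. f t * indicator {a..b} t \<partial>lborel) = emeasure ?M {a..b}"
      by (simp add: fM[symmetric] emeasure_density)
    also have "\<dots> = emeasure lborel (G -` {a..b})" by (simp add: emeasure_distr)
    also have "G -` {a..b} = {F a..F b}"
      using F_le_iff[of a "G _"] F_le_iff[of "G _" b] by (auto simp: FG)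
    finally show ?thesis using that F_le_iff by simp
  qed
  \<comment> \<open>The Radon-Nikodym density takes extended values. Its mass on each interval
    \<open>{- real n..real n}\<close> is finite, so it can be made real off a null set.\<close>
  have "AE t in lborel. f t \<noteq> \<infinity>"
  proof -
    have "AE t in lborel. f t * indicator {- real n..real n} t \<noteq> \<infinity>" for n
      by (rule nn_integral_PInf_AE) (auto simp: nn)
    then have "AE t in lborel. \<forall>n::nat. f t * indicator {- real n..real n} t \<noteq> \<infinity>"
      by (simp add: AE_all_countable)
    then show ?thesis
    proof eventually_elim
      case (elim t)
      obtain n :: nat where "\<bar>t\<bar> \<le> real n" using real_arch_simple by blast
      then show ?case using elim[rule_format, of n] by (auto simp: indicator_def abs_le_iff)
    qed
  qed
  then have AE_f: "AE t in lborel. f t = ennreal (enn2real (f t))"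
    by eventually_elim (simp add: less_top)
  define k where "k t = enn2real (f t)" for t
  have k_meas[measurable]: "k \<in> borel_measurable borel" unfolding k_def by measurable
  have k_nn: "(\<integral>\<^sup>+t. ennreal (indicator {a..b} t * k t) \<partial>lborel) = ennreal (F b - F a)" if "a \<le> b" for a b
  proof -
    have "(\<integral>\<^sup>+t. ennreal (indicator {a..b} t * k t) \<partial>lborel) = (\<integral>\<^sup>+t. f t * indicator {a..b} t \<partial>lborel)"
      by (rule nn_integral_cong_AE) (use AE_f in eventually_elim, auto simp: k_def indicator_def)
    then show ?thesis using nn that by simp
  qed
  have k_int: "has_bochner_integral lborel (\<lambda>t. indicator {a..b} t * k t) (F b - F a)" if "a \<le> b" for a b
    by (rule has_bochner_integral_nn_integral) (use k_nn that F_le_iff in \<open>auto simp: k_def\<close>)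
  define h where "h t = k t - (L + 1)" for t
  have "has_bochner_integral lborel (\<lambda>t. indicator {a..b} t * h t) (\<phi> b - \<phi> a)" if ab: "a \<le> b" for a b
  proof -
    have "has_bochner_integral lborel (\<lambda>t. indicator {a..b} t *\<^sub>R (L + 1)) (measure lborel {a..b} *\<^sub>R (L + 1))"
      using has_bochner_integral_indicator[of "{a..b}" lborel "L + 1"] ab
      by (simp add: less_top[symmetric])
    from has_bochner_integral_diff[OF k_int[OF ab] this]
    show ?thesis using ab by (simp add: h_def F_def algebra_simps)
  qed note h = this
  show ?thesis
  proof
    show "h \<in> borel_measurable borel" unfolding h_def by measurable
  qed (use h in \<open>auto simp: set_integrable_def set_lebesgue_integral_def has_bochner_integral_iff\<close>)
qed

text \<open>Lebesgue differentiation of the density gives the right derivative. One null set of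
  \<open>t\<close> serves all speeds \<open>c\<close>, since \<open>c / real (Suc n)\<close> tends
  to 0 from the right for each of them; the increments are one-sided, hence \<open>c > 0\<close>.
  The integral and the limit refer to the same \<open>h\<close>, which later turns derivatives into
  increments.\<close>

lemma lipschitz_real_AE_derivative:
  fixes \<phi> :: "real \<Rightarrow> real"
  assumes lip: "L-lipschitz_on UNIV \<phi>"
  obtains h where "h \<in> borel_measurable borel"
    "(LINT t:{0..1}|lborel. h t) = \<phi> 1 - \<phi> 0"
    "AE t in lborel. \<forall>c>0. (\<lambda>n. real (Suc n) * (\<phi> (t + c / real (Suc n)) - \<phi> t)) \<longlonglongrightarrow> c * h t"
proof -
  obtain h where h: "h \<in> borel_measurable borel"
    "\<And>a b. a \<le> b \<Longrightarrow> set_integrable lborel {a..b} h"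
    "\<And>a b. a \<le> b \<Longrightarrow> (LINT t:{a..b}|lborel. h t) = \<phi> b - \<phi> a"
    using lipschitz_real_density[OF lip] by metis
  have hi: "(h has_integral (\<phi> b - \<phi> a)) {a..b}" if "a \<le> b" for a b
    using set_borel_integral_eq_integral[OF h(2)[OF that]] h(3)[OF that] by (simp add: has_integral_iff)
  have "h integrable_on cbox a b" for a b
    using hi[of a b] by (cases "a \<le> b") auto
  then obtain N where N: "negligible N"
    "\<And>x e. \<lbrakk>x \<notin> N; 0 < e\<rbrakk> \<Longrightarrow> \<exists>d>0. \<forall>s. 0 < s \<and> s < d \<longrightarrow>
       norm (integral (cbox x (x + s *\<^sub>R One)) h /\<^sub>R s ^ DIM(real) - h x) < e"
    using integrable_ccontinuous_explicit[of h] by blast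
  have "AE t in lborel. t \<notin> N"
    using N(1) AE_not_in[of N lebesgue] by (simp add: negligible_iff_null_sets AE_completion_iff)
  then have AE: "AE t in lborel. \<forall>c>0. (\<lambda>n. real (Suc n) * (\<phi> (t + c / real (Suc n)) - \<phi> t)) \<longlonglongrightarrow> c * h t"
  proof eventually_elim
    case (elim t)
    have "((\<lambda>s. (\<phi> (t + s) - \<phi> t) / s) \<longlongrightarrow> h t) (at_right 0)"
    proof (rule tendstoI)
      fix e :: real assume "0 < e"
      then obtain d where "d > 0" and d: "\<forall>s. 0 < s \<and> s < d \<longrightarrow>
         norm (integral (cbox t (t + s *\<^sub>R One)) h /\<^sub>R s ^ DIM(real) - h t) < e"
        using N(2)[OF elim] by blast
      have "dist ((\<phi> (t + s) - \<phi> t) / s) (h t) < e" if "0 < s" "s < d" for s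
        using d[rule_format, of s] that hi[of t "t + s"]
        by (simp add: integral_unique dist_real_def divide_inverse mult.commute)
      then show "\<forall>\<^sub>F s in at_right 0. dist ((\<phi> (t + s) - \<phi> t) / s) (h t) < e"
        unfolding eventually_at_right_field using \<open>d > 0\<close> by auto
    qed
    moreover have "filterlim (\<lambda>n. c / real (Suc n)) (at_right 0) sequentially" if "c > 0" for c :: real
    proof -
      have "(\<lambda>n. c / real (Suc n)) \<longlonglongrightarrow> 0"
        using tendsto_mult_right_zero[OF LIMSEQ_inverse_real_of_nat, of c] by (simp add: divide_inverse)
      then show ?thesis using that
        by (auto simp: filterlim_at intro!: always_eventually)
    qed
    ultimately have lim: "(\<lambda>n. (\<phi> (t + c / real (Suc n)) - \<phi> t) / (c / real (Suc n))) \<longlonglongrightarrow> h t" if "c > 0" for c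
      using that filterlim_compose by fast
    show ?case
    proof (intro allI impI)
      fix c :: real assume "c > 0"
      have "c * (u / (c / real (Suc n))) = real (Suc n) * u" for u n
        using \<open>c > 0\<close> by (simp del: of_nat_Suc)
      with tendsto_mult_left[OF lim[OF \<open>c > 0\<close>], of c]
      show "(\<lambda>n. real (Suc n) * (\<phi> (t + c / real (Suc n)) - \<phi> t)) \<longlonglongrightarrow> c * h t"
        by (simp del: of_nat_Suc)
    qed
  qed
  show ?thesis using that[OF h(1) _ AE] h(3)[of 0 1] by simp
qed

section \<open>Almost everywhere arguments along lines\<close>

lemma AE_lborelE:
  assumes "AE x in lborel. P x"
  obtains N where "N \<in> null_sets lborel" "\<And>x. x \<notin> N \<Longrightarrow> P x"
  using assms unfolding eventually_ae_filter by auto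

lemma AE_lborel_affine:
  fixes t :: "'a::euclidean_space"
  assumes "AE x in lborel. P x" "c \<noteq> 0"
  shows "AE x in lborel. P (t + c *\<^sub>R x)"
proof -
  obtain N where N: "N \<in> null_sets lborel" "\<And>x. x \<notin> N \<Longrightarrow> P x"
    by (rule AE_lborelE[OF assms(1)]) blast
  then have [measurable]: "N \<in> sets borel" by auto
  have "AE x in density (distr lborel borel (\<lambda>x. t + c *\<^sub>R x)) (\<lambda>_. \<bar>c\<bar>^DIM('a)). x \<notin> N"
    by (subst lborel_affine[OF assms(2), of t, symmetric]) (rule AE_not_in[OF N(1)])
  then have "AE x in distr lborel borel (\<lambda>x. t + c *\<^sub>R x). x \<notin> N"
    using assms(2) by (subst (asm) AE_density) auto
  then have "AE x in lborel. t + c *\<^sub>R x \<notin> N"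
    by (subst (asm) AE_distr_iff) auto
  then show ?thesis by eventually_elim (rule N)
qed

lemma AE_lborel_ex:
  assumes "AE x in (lborel :: 'a::euclidean_space measure). P x"
  obtains x where "P x"
proof -
  have "ae_filter (lborel :: 'a measure) \<noteq> bot" by (simp add: ae_filter_eq_bot_iff)
  then show ?thesis using eventually_happens[OF assms] that by (auto simp: trivial_limit_def)
qed

text \<open>By Fubini on pairs of a point and a parameter, some \<open>t\<close> works for almost
  every \<open>x\<close>, and translation by \<open>t *\<^sub>R v\<close> removes it. No coordinate
  along \<open>v\<close> is split off, so \<open>v = 0\<close> is not special.\<close>

lemma AE_if_AE_lines:
  fixes v :: "'a::euclidean_space"
  assumes [measurable]: "Measurable.pred borel P"
    and lines: "\<And>x. AE t in lborel. P (x + t *\<^sub>R v)"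
  shows "AE x in lborel. P x"
proof -
  have "AE t in lborel. AE x in lborel. P (x + t *\<^sub>R v)"
  proof (subst lborel_pair.AE_commute[symmetric])
    show "{x \<in> space (lborel \<Otimes>\<^sub>M lborel). P (fst x + snd x *\<^sub>R v)} \<in> sets (lborel \<Otimes>\<^sub>M lborel)"
      by measurable
  qed (use lines in auto)
  then obtain t where "AE x in lborel. P (x + t *\<^sub>R v)" by (rule AE_lborel_ex)
  from AE_lborel_affine[OF this, of 1 "- t *\<^sub>R v"] show ?thesis by simp
qed

text \<open>For fixed \<open>t \<noteq> 0\<close> the point on the segment is a nonsingular affine
  function of \<open>y\<close>, so it avoids a null set for almost every \<open>y\<close>; Fubini
  exchanges the two quantifiers.\<close>

lemma AE_segment:
  fixes x :: "'a::euclidean_space"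
  assumes "AE z in lborel. P z"
  shows "AE y in lborel. AE t in lborel. P (x + t *\<^sub>R (y - x))"
proof -
  \<comment> \<open>\<open>P\<close> is arbitrary; a Borel null set containing its exceptions
    supplies the measurability that Fubini needs.\<close>
  obtain N where N: "N \<in> null_sets lborel" "\<And>x. x \<notin> N \<Longrightarrow> P x"
    by (rule AE_lborelE[OF assms]) blast
  then have [measurable]: "N \<in> sets borel" by auto
  have "AE t in lborel. AE y in lborel. x + t *\<^sub>R (y - x) \<notin> N"
    using AE_lborel_singleton[of "0::real"]
  proof eventually_elim
    case (elim t)
    have eq: "(1 - t) *\<^sub>R x + t *\<^sub>R y = x + t *\<^sub>R (y - x)" for y by (simp add: algebra_simps)
    show ?case using AE_lborel_affine[OF AE_not_in[OF N(1)] elim, of "(1 - t) *\<^sub>R x"] by (simp only: eq)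
  qed
  moreover have "{w \<in> space (lborel \<Otimes>\<^sub>M lborel). x + snd w *\<^sub>R (fst w - x) \<notin> N}
      \<in> sets ((lborel :: 'a measure) \<Otimes>\<^sub>M (lborel :: real measure))"
    by measurable
  ultimately have "AE y in lborel. AE t in lborel. x + t *\<^sub>R (y - x) \<notin> N"
    by (subst lborel_pair.AE_commute)
  then show ?thesis by (auto elim!: eventually_mono intro: N)
qed

text \<open>Compatibility speaks of almost every pair, so the Fubini argument is repeated with the
  pair \<open>w\<close> as one variable; a fixed \<open>x\<close> at a time would leave
  measurability on the product open.\<close>

lemma AE_pair_segment:
  assumes "AE z in (lborel :: 'a::euclidean_space measure). P z"
  shows "AE w in lborel \<Otimes>\<^sub>M lborel. AE t in lborel. P (fst w + t *\<^sub>R (snd w - fst w))"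
proof -
  obtain N where N: "N \<in> null_sets lborel" "\<And>x. x \<notin> N \<Longrightarrow> P x"
    by (rule AE_lborelE[OF assms]) blast
  then have [measurable]: "N \<in> sets borel" by auto
  have "AE t in lborel. AE w in (lborel \<Otimes>\<^sub>M lborel). fst w + t *\<^sub>R (snd w - fst w) \<notin> N"
    using AE_lborel_singleton[of "0::real"]
  proof eventually_elim
    case (elim t)
    show ?case
    proof (rule lborel_pair.AE_pair_measure)
      show "AE x in lborel. AE y in lborel. fst (x, y) + t *\<^sub>R (snd (x, y) - fst (x, y)) \<notin> N"
      proof (rule AE_I2)
        fix x :: 'a
        have eq: "(1 - t) *\<^sub>R x + t *\<^sub>R y = x + t *\<^sub>R (y - x)" for y by (simp add: algebra_simps)
        show "AE y in lborel. fst (x, y) + t *\<^sub>R (snd (x, y) - fst (x, y)) \<notin> N"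
          using AE_lborel_affine[OF AE_not_in[OF N(1)] elim, of "(1 - t) *\<^sub>R x"] by (simp add: eq)
      qed
    qed measurable
  qed
  then have "AE t in lborel. AE w in lborel. fst w + t *\<^sub>R (snd w - fst w) \<notin> N"
    unfolding lborel_prod .
  moreover have "{w \<in> space (lborel \<Otimes>\<^sub>M lborel). fst (fst w) + snd w *\<^sub>R (snd (fst w) - fst (fst w)) \<notin> N}
      \<in> sets ((lborel :: ('a \<times> 'a) measure) \<Otimes>\<^sub>M (lborel :: real measure))"
    unfolding lborel_prod[symmetric] by measurable
  ultimately have "AE w in lborel. AE t in lborel. fst w + t *\<^sub>R (snd w - fst w) \<notin> N"
    by (subst lborel_pair.AE_commute)
  then show ?thesis unfolding lborel_prod by (auto elim!: eventually_mono intro: N)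
qed

text \<open>With \<open>c\<close> above the bound, \<open>1 + k x / c\<close> is a nonnegative
  density. Its measure agrees with Lebesgue measure on boxes, hence everywhere, and densities are
  unique almost everywhere.\<close>

lemma AE_zero_if_box_integrals_zero:
  fixes k :: "'a::euclidean_space \<Rightarrow> real"
  assumes [measurable]: "k \<in> borel_measurable borel"
    and bound: "AE x in lborel. \<bar>k x\<bar> \<le> C"
    and zero: "\<And>a b. (LINT x:box a b|lborel. k x) = 0"
  shows "AE x in lborel. k x = 0"
proof -
  define c where "c = \<bar>C\<bar> + 1"
  have c: "c > 0" "AE x in lborel. \<bar>k x\<bar> \<le> c"
    using bound by (auto simp: c_def elim!: eventually_mono)
  have "lborel = density lborel (\<lambda>x. ennreal (1 + k x / c))"
  proof (rule lborel_eqI)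
    fix l u :: 'a assume le: "\<And>b. b \<in> Basis \<Longrightarrow> l \<bullet> b \<le> u \<bullet> b"
    have fin: "emeasure lborel (box l u) < \<infinity>" using emeasure_lborel_box_finite by simp
    have ik: "integrable lborel (\<lambda>x. indicator (box l u) x *\<^sub>R k x)"
      by (rule integrableI_bounded_set_indicator[where B=c])
        (use fin c in \<open>auto elim!: eventually_mono\<close>)
    have i1: "integrable lborel (indicator (box l u) :: 'a \<Rightarrow> real)"
      using fin by simp
    have "emeasure (density lborel (\<lambda>x. ennreal (1 + k x / c))) (box l u)
        = (\<integral>\<^sup>+x. ennreal (1 + k x / c) * indicator (box l u) x \<partial>lborel)"
      by (simp add: emeasure_density)
    also have "\<dots> = (\<integral>\<^sup>+x. ennreal (indicator (box l u) x + (indicator (box l u) x *\<^sub>R k x) / c) \<partial>lborel)"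
      by (intro nn_integral_cong) (auto simp: indicator_def)
    also have "\<dots> = ennreal (\<integral>x. indicator (box l u) x + (indicator (box l u) x *\<^sub>R k x) / c \<partial>lborel)"
    proof (rule nn_integral_eq_integral)
      show "AE x in lborel. 0 \<le> indicator (box l u) x + (indicator (box l u) x *\<^sub>R k x) / c"
        using c(2) by eventually_elim (use c(1) in \<open>auto simp: indicator_def field_simps abs_le_iff\<close>)
    qed (use ik i1 in auto)
    also have "(\<integral>x. indicator (box l u) x + (indicator (box l u) x *\<^sub>R k x) / c \<partial>lborel)
        = measure lborel (box l u)"
      using ik i1 zero[of l u] by (simp add: set_lebesgue_integral_def)
    also have "ennreal (measure lborel (box l u)) = (\<Prod>b\<in>Basis. (u - l) \<bullet> b)"
      using le by (simp add: measure_lborel_box_eq)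
    finally show "emeasure (density lborel (\<lambda>x. ennreal (1 + k x / c))) (box l u) = (\<Prod>b\<in>Basis. (u - l) \<bullet> b)" .
  qed simp
  then have "density lborel (\<lambda>x. ennreal (1 + k x / c)) = density lborel (\<lambda>_. 1)"
    by (simp add: density_1)
  then have "AE x in lborel. ennreal (1 + k x / c) = 1"
    by (subst (asm) sigma_finite_measure.density_unique_iff[OF sigma_finite_lborel]) auto
  then show ?thesis
    by eventually_elim (use c(1) in \<open>auto simp: ennreal_eq_1\<close>)
qed

text \<open>Difference quotients are taken only along the steps \<open>1 / (n + 1)\<close>. The limit is then a Borel
  function (with an arbitrary value where it does not exist), and this is enough to recover \<open>f\<close>
  along segments.\<close>

definition diff_quot :: "('a::euclidean_space \<Rightarrow> real) \<Rightarrow> 'a \<Rightarrow> nat \<Rightarrow> 'a \<Rightarrow> real" where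
  "diff_quot f v n x = real (Suc n) * (f (x + v /\<^sub>R real (Suc n)) - f x)"

definition dir_deriv :: "('a::euclidean_space \<Rightarrow> real) \<Rightarrow> 'a \<Rightarrow> 'a \<Rightarrow> real" where
  "dir_deriv f v x = lim (\<lambda>n. diff_quot f v n x)"

text \<open>The factor \<open>real (Suc n)\<close> cancels the step, so the bound is uniform in
  \<open>n\<close>. This gives the dominating functions for limits under the integral and the
  passage from a dense set of directions to all.\<close>

lemma diff_quot_lipschitz:
  assumes "L-lipschitz_on UNIV f"
  shows "\<bar>diff_quot f v n x - diff_quot f w n x\<bar> \<le> L * norm (v - w)"
proof -
  have "\<bar>f (x + v /\<^sub>R real (Suc n)) - f (x + w /\<^sub>R real (Suc n))\<bar>
      \<le> L * norm ((v - w) /\<^sub>R real (Suc n))"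
    using lipschitz_onD[OF assms, of "x + v /\<^sub>R real (Suc n)" "x + w /\<^sub>R real (Suc n)"]
    by (simp add: dist_real_def dist_norm scaleR_diff_right del: of_nat_Suc)
  also have "\<dots> = L * norm (v - w) / real (Suc n)"
    by (simp add: divide_inverse del: of_nat_Suc)
  finally have "real (Suc n) * \<bar>f (x + v /\<^sub>R real (Suc n)) - f (x + w /\<^sub>R real (Suc n))\<bar> \<le> L * norm (v - w)"
    by (simp add: field_simps del: of_nat_Suc)
  moreover have "\<bar>diff_quot f v n x - diff_quot f w n x\<bar>
      = real (Suc n) * \<bar>f (x + v /\<^sub>R real (Suc n)) - f (x + w /\<^sub>R real (Suc n))\<bar>"
    by (simp add: diff_quot_def right_diff_distrib[symmetric] abs_mult del: of_nat_Suc)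
  ultimately show ?thesis by simp
qed

lemma diff_quot_zero [simp]: "diff_quot f 0 n x = 0"
  by (simp add: diff_quot_def)

lemma diff_quot_bound:
  assumes "L-lipschitz_on UNIV f"
  shows "\<bar>diff_quot f v n x\<bar> \<le> L * norm v"
  using diff_quot_lipschitz[OF assms, of v n x 0] by simp

lemma borel_measurable_diff_quot:
  assumes "L-lipschitz_on UNIV f"
  shows "diff_quot f v n \<in> borel_measurable borel"
proof -
  have "continuous_on UNIV f" using assms by (rule lipschitz_on_continuous_on)
  then have [measurable]: "f \<in> borel_measurable borel" by (rule borel_measurable_continuous_onI)
  show ?thesis unfolding diff_quot_def by measurable
qed

lemma borel_measurable_dir_deriv:
  assumes "L-lipschitz_on UNIV f"
  shows "dir_deriv f v \<in> borel_measurable borel"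
  unfolding dir_deriv_def
  using borel_measurable_diff_quot[OF assms] by (rule borel_measurable_lim_metric)

lemma lipschitz_on_line:
  fixes f :: "'a::real_normed_vector \<Rightarrow> real"
  assumes lip: "L-lipschitz_on UNIV f"
  shows "(L * norm v)-lipschitz_on UNIV (\<lambda>t. f (x + t *\<^sub>R v))"
proof (rule lipschitz_onI)
  fix s t
  have "x + s *\<^sub>R v - (x + t *\<^sub>R v) = (s - t) *\<^sub>R v" by (simp add: algebra_simps)
  then show "dist (f (x + s *\<^sub>R v)) (f (x + t *\<^sub>R v)) \<le> L * norm v * dist s t"
    using lipschitz_onD[OF lip, of "x + s *\<^sub>R v" "x + t *\<^sub>R v"]
    by (simp add: dist_norm mult_ac)
qed (use lipschitz_on_nonneg[OF lip] in simp)

text \<open>Quotients in direction \<open>c *\<^sub>R v\<close> use the steps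
  \<open>c / real (Suc n)\<close>, a different sequence from the one defining
  \<open>dir_deriv f v\<close>. Homogeneity is therefore not automatic; it comes from the
  one-dimensional lemma, where one \<open>h\<close> serves all \<open>c\<close>.\<close>

lemma AE_diff_quot_scaled:
  assumes lip: "L-lipschitz_on UNIV f" and c: "c > 0"
  shows "AE x in lborel. (\<lambda>n. diff_quot f (c *\<^sub>R v) n x) \<longlonglongrightarrow> c * dir_deriv f v x"
proof -
  note [measurable] = borel_measurable_dir_deriv[OF lip]
  have [measurable]: "(\<lambda>x. diff_quot f w n x) \<in> borel_measurable borel" for w n
    using borel_measurable_diff_quot[OF lip] .
  \<comment> \<open>Convergence and the value of \<open>lim\<close> are separately Borel conditions,
    which makes the predicate measurable as \<open>AE_if_AE_lines\<close> requires.\<close>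
  have eq: "(\<lambda>n. diff_quot f (c *\<^sub>R v) n x) \<longlonglongrightarrow> y \<longleftrightarrow>
      convergent (\<lambda>n. diff_quot f (c *\<^sub>R v) n x) \<and> lim (\<lambda>n. diff_quot f (c *\<^sub>R v) n x) = y" for x y
    using convergent_LIMSEQ_iff limI by (metis convergentI)
  show ?thesis
  proof (rule AE_if_AE_lines[where v=v])
    show "Measurable.pred borel (\<lambda>x. (\<lambda>n. diff_quot f (c *\<^sub>R v) n x) \<longlonglongrightarrow> c * dir_deriv f v x)"
      unfolding eq
    proof (intro pred_intros_logic)
      show "Measurable.pred borel (\<lambda>x. convergent (\<lambda>n. diff_quot f (c *\<^sub>R v) n x))"
        unfolding Cauchy_convergent_iff[symmetric] by measurable
    qed measurable
    fix x
    define \<phi> where "\<phi> t = f (x + t *\<^sub>R v)" for t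
    have "(L * norm v)-lipschitz_on UNIV \<phi>" unfolding \<phi>_def by (rule lipschitz_on_line[OF lip])
    then obtain h where
      "AE t in lborel. \<forall>c>0. (\<lambda>n. real (Suc n) * (\<phi> (t + c / real (Suc n)) - \<phi> t)) \<longlonglongrightarrow> c * h t"
      by (rule lipschitz_real_AE_derivative)
    then show "AE t in lborel. (\<lambda>n. diff_quot f (c *\<^sub>R v) n (x + t *\<^sub>R v)) \<longlonglongrightarrow> c * dir_deriv f v (x + t *\<^sub>R v)"
    proof eventually_elim
      case (elim t)
      have dq: "diff_quot f (s *\<^sub>R v) n (x + t *\<^sub>R v) = real (Suc n) * (\<phi> (t + s / real (Suc n)) - \<phi> t)" for s n
        by (simp add: diff_quot_def \<phi>_def scaleR_add_left divide_inverse add.assoc mult.commute del: of_nat_Suc)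
      have "(\<lambda>n. diff_quot f v n (x + t *\<^sub>R v)) \<longlonglongrightarrow> h t"
        using elim[rule_format, of 1] dq[of 1] by simp
      then have "dir_deriv f v (x + t *\<^sub>R v) = h t"
        unfolding dir_deriv_def by (rule limI)
      then show ?case using elim c by (simp add: dq del: of_nat_Suc)
    qed
  qed
qed

lemma AE_diff_quot:
  assumes lip: "L-lipschitz_on UNIV f"
  shows "AE x in lborel. (\<lambda>n. diff_quot f v n x) \<longlonglongrightarrow> dir_deriv f v x"
  using AE_diff_quot_scaled[OF lip, of 1 v] by simp

section \<open>Rademacher differentiability\<close>

lemma AE_dir_deriv_bound:
  assumes lip: "L-lipschitz_on UNIV f"
  shows "AE x in lborel. \<bar>dir_deriv f v x\<bar> \<le> L * norm v"
  using AE_diff_quot[OF lip, of v]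
proof eventually_elim
  case (elim x)
  show ?case
    by (rule LIMSEQ_le_const2[OF tendsto_rabs[OF elim]]) (use diff_quot_bound[OF lip] in auto)
qed

lemma lborel_integral_translate:
  fixes F :: "'a::euclidean_space \<Rightarrow> real"
  assumes [measurable]: "F \<in> borel_measurable borel"
  shows "(\<integral>x. F (c + x) \<partial>lborel) = (\<integral>x. F x \<partial>lborel)"
proof -
  have "(\<integral>x. F x \<partial>lborel) = (\<integral>x. F x \<partial>distr lborel borel ((+) c))"
    by (simp add: lborel_distr_plus)
  also have "\<dots> = (\<integral>x. F (c + x) \<partial>lborel)" by (rule integral_distr) measurable
  finally show ?thesis by simp
qed

text \<open>For a box \<open>B\<close>, the integral over \<open>B\<close> of \<open>f (x + (u + v) / n) - f (x + u / n)\<close> is that of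
  \<open>f (x + v / n) - f x\<close> over the translate \<open>B + u / n\<close>, whose indicator tends to that of \<open>B\<close>. Hence
  both sides have the same integral over every box.\<close>

lemma AE_dir_deriv_add:
  fixes f :: "'a::euclidean_space \<Rightarrow> real"
  assumes lip: "L-lipschitz_on UNIV f"
  shows "AE x in lborel. dir_deriv f (u + v) x = dir_deriv f u x + dir_deriv f v x"
proof -
  note [measurable] = borel_measurable_dir_deriv[OF lip]
  have [measurable]: "(\<lambda>x. diff_quot f w n x) \<in> borel_measurable borel" for w n
    using borel_measurable_diff_quot[OF lip] .
  have L0: "0 \<le> L" using lip by (rule lipschitz_on_nonneg)
  define k where "k x = dir_deriv f (u + v) x - dir_deriv f u x - dir_deriv f v x" for x
  have "AE x in lborel. k x = 0"
  proof (rule AE_zero_if_box_integrals_zero)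
    show "k \<in> borel_measurable borel" unfolding k_def by measurable
    show "AE x in lborel. \<bar>k x\<bar> \<le> L * norm (u + v) + L * norm u + L * norm v"
      using AE_dir_deriv_bound[OF lip, of "u + v"] AE_dir_deriv_bound[OF lip, of u]
        AE_dir_deriv_bound[OF lip, of v]
      by eventually_elim (simp add: k_def)
    fix a b :: 'a
    define B where "B = box a b"
    have [measurable]: "B \<in> sets borel" by (simp add: B_def)
    obtain R where R: "B \<subseteq> cball 0 R" unfolding B_def using bounded_box[of a b] by (auto simp: bounded_iff subset_eq)
    have B_fin: "emeasure lborel B < \<infinity>" unfolding B_def using emeasure_lborel_box_finite by simp
    have int: "integrable lborel (\<lambda>x. indicator B x * g x)"
      if [measurable]: "g \<in> borel_measurable borel" and "AE x in lborel. \<bar>g x\<bar> \<le> C" for g :: "'a \<Rightarrow> real" and C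
    proof -
      have "AE x in lborel. x \<in> B \<longrightarrow> norm (g x) \<le> C"
        using that(2) by eventually_elim simp
      then show ?thesis
        using integrableI_bounded_set_indicator[of B lborel g C] B_fin by simp
    qed
    have int_dq: "integrable lborel (\<lambda>x. indicator B x * diff_quot f w n x)" for w n
      by (rule int) (use diff_quot_bound[OF lip] in auto)
    have int_dd: "integrable lborel (\<lambda>x. indicator B x * dir_deriv f w x)" for w
      by (rule int) (use AE_dir_deriv_bound[OF lip] in auto)
    have lim: "(\<lambda>n. \<integral>x. indicator B x * diff_quot f w n x \<partial>lborel) \<longlonglongrightarrow> (\<integral>x. indicator B x * dir_deriv f w x \<partial>lborel)" for w
    proof (rule integral_dominated_convergence)
      show "integrable lborel (\<lambda>x. indicator B x * (L * norm w))"
        by (rule int) auto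
      show "AE x in lborel. (\<lambda>n. indicator B x * diff_quot f w n x) \<longlonglongrightarrow> indicator B x * dir_deriv f w x"
        using AE_diff_quot[OF lip, of w] by eventually_elim (rule tendsto_mult_left)
      show "AE x in lborel. norm (indicator B x * diff_quot f w n x) \<le> indicator B x * (L * norm w)" for n
        using diff_quot_bound[OF lip] by (auto simp: indicator_def)
    qed measurable
    have shift_lim: "(\<lambda>n. x - u /\<^sub>R real (Suc n)) \<longlonglongrightarrow> x" for x
    proof -
      have "(\<lambda>n. x - inverse (real (Suc n)) *\<^sub>R u) \<longlonglongrightarrow> x - 0 *\<^sub>R u"
        by (intro tendsto_intros LIMSEQ_inverse_real_of_nat)
      then show ?thesis by simp
    qed
    \<comment> \<open>The translated indicators can fail to converge only on the boundary of the
      box, a null set.\<close>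
    have ind_lim: "AE x in lborel. (\<lambda>n. indicator B (x - u /\<^sub>R real (Suc n)) :: real) \<longlonglongrightarrow> indicator B x"
    proof -
      have "cbox a b - box a b \<in> null_sets lborel"
        using negligible_frontier_interval[of a b] by (auto simp: negligible_iff_null_sets null_sets_def)
      then show ?thesis
      proof (rule eventually_mono[OF AE_not_in])
        fix x assume x: "x \<notin> cbox a b - box a b"
        have "\<forall>\<^sub>F n in sequentially. indicator B (x - u /\<^sub>R real (Suc n)) = (indicator B x :: real)"
        proof (cases "x \<in> B")
          case True
          then have "\<forall>\<^sub>F n in sequentially. x - u /\<^sub>R real (Suc n) \<in> B"
            using topological_tendstoD[OF shift_lim open_box] unfolding B_def by blast
          then show ?thesis by eventually_elim (simp add: True)
        next
          case False
          then have "\<forall>\<^sub>F n in sequentially. x - u /\<^sub>R real (Suc n) \<in> - cbox a b"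
            using topological_tendstoD[OF shift_lim open_Compl[OF closed_cbox]] x unfolding B_def by blast
          then show ?thesis
            by eventually_elim (use False box_subset_cbox[of a b] in \<open>auto simp: B_def indicator_def\<close>)
        qed
        then show "(\<lambda>n. indicator B (x - u /\<^sub>R real (Suc n)) :: real) \<longlonglongrightarrow> indicator B x"
          by (rule tendsto_eventually)
      qed
    qed
    have lim': "(\<lambda>n. \<integral>x. indicator B (x - u /\<^sub>R real (Suc n)) * diff_quot f v n x \<partial>lborel)
        \<longlonglongrightarrow> (\<integral>x. indicator B x * dir_deriv f v x \<partial>lborel)"
    proof (rule integral_dominated_convergence)
      \<comment> \<open>All translates of the box lie in this ball, since no shift is longer than
        \<open>norm u\<close>.\<close>
      show "integrable lborel (\<lambda>x. indicator (cball 0 (R + norm u)) x * (L * norm v))"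
        by (intro integrable_mult_left integrable_real_indicator emeasure_lborel_cball_finite) simp
      show "AE x in lborel. (\<lambda>n. indicator B (x - u /\<^sub>R real (Suc n)) * diff_quot f v n x)
          \<longlonglongrightarrow> indicator B x * dir_deriv f v x"
        using ind_lim AE_diff_quot[OF lip, of v] by eventually_elim (rule tendsto_mult)
      show "AE x in lborel. norm (indicator B (x - u /\<^sub>R real (Suc n)) * diff_quot f v n x)
          \<le> indicator (cball 0 (R + norm u)) x * (L * norm v)" for n
      proof (rule AE_I2)
        fix x
        have "x \<in> cball 0 (R + norm u)" if "x - u /\<^sub>R real (Suc n) \<in> B"
        proof -
          have "norm (u /\<^sub>R real (Suc n)) \<le> norm u"
            by (simp add: mult_left_le_one_le inverse_le_1_iff)
          moreover have "norm (x - u /\<^sub>R real (Suc n)) \<le> R" using that R by auto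
          moreover have "norm x \<le> norm (x - u /\<^sub>R real (Suc n)) + norm (u /\<^sub>R real (Suc n))"
            by (metis diff_add_cancel norm_triangle_ineq)
          ultimately show ?thesis by simp
        qed
        then show "norm (indicator B (x - u /\<^sub>R real (Suc n)) * diff_quot f v n x)
            \<le> indicator (cball 0 (R + norm u)) x * (L * norm v)"
          using diff_quot_bound[OF lip, of v n x] L0 by (auto simp: indicator_def)
      qed
    qed measurable
    have split: "(\<integral>x. indicator B x * diff_quot f (u + v) n x \<partial>lborel)
        = (\<integral>x. indicator B (x - u /\<^sub>R real (Suc n)) * diff_quot f v n x \<partial>lborel)
          + (\<integral>x. indicator B x * diff_quot f u n x \<partial>lborel)" for n
    proof -
      define c where "c = u /\<^sub>R real (Suc n)"
      have dq: "diff_quot f (u + v) n x = diff_quot f v n (c + x) + diff_quot f u n x" for x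
        by (simp add: diff_quot_def c_def scaleR_add_right algebra_simps del: of_nat_Suc)
      have "integrable lborel (\<lambda>x. indicator B x * diff_quot f v n (c + x))"
        by (rule int) (use diff_quot_bound[OF lip] in auto)
      then have "(\<integral>x. indicator B x * diff_quot f (u + v) n x \<partial>lborel)
          = (\<integral>x. indicator B x * diff_quot f v n (c + x) \<partial>lborel) + (\<integral>x. indicator B x * diff_quot f u n x \<partial>lborel)"
        using int_dq[of u n] by (simp add: dq distrib_left)
      also have "(\<integral>x. indicator B x * diff_quot f v n (c + x) \<partial>lborel)
          = (\<integral>x. indicator B (x - c) * diff_quot f v n x \<partial>lborel)"
        using lborel_integral_translate[of "\<lambda>x. indicator B (x - c) * diff_quot f v n x" c] by simp
      finally show ?thesis by (simp add: c_def)
    qed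
    have "(\<integral>x. indicator B x * dir_deriv f (u + v) x \<partial>lborel)
        = (\<integral>x. indicator B x * dir_deriv f v x \<partial>lborel) + (\<integral>x. indicator B x * dir_deriv f u x \<partial>lborel)"
      using lim[of "u + v"] tendsto_add[OF lim' lim[of u]] unfolding split by (rule LIMSEQ_unique)
    then show "(LINT x:box a b|lborel. k x) = 0"
      using int_dd by (simp add: set_lebesgue_integral_def k_def B_def[symmetric] right_diff_distrib)
  qed
  then show ?thesis by eventually_elim (simp add: k_def)
qed

lemma dir_deriv_zero [simp]: "dir_deriv f 0 x = 0"
  by (simp add: dir_deriv_def)

text \<open>One-sided steps say nothing directly about the opposite direction. Negative factors come
  from additivity: \<open>c *\<^sub>R v\<close> and \<open>(- c) *\<^sub>R v\<close> add up to 0,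
  whose derivative is 0.\<close>

lemma AE_dir_deriv_scale:
  assumes lip: "L-lipschitz_on UNIV f"
  shows "AE x in lborel. dir_deriv f (c *\<^sub>R v) x = c * dir_deriv f v x"
proof -
  have pos: "AE x in lborel. dir_deriv f (d *\<^sub>R v) x = d * dir_deriv f v x" if "d > 0" for d
    using AE_diff_quot_scaled[OF lip that, of v] AE_diff_quot[OF lip, of "d *\<^sub>R v"]
    by eventually_elim (rule LIMSEQ_unique)
  consider "c > 0" | "c = 0" | "- c > 0" by linarith
  then show ?thesis
  proof cases
    case 3
    show ?thesis
      using pos[OF 3] AE_dir_deriv_add[OF lip, of "c *\<^sub>R v" "(- c) *\<^sub>R v"]
      by eventually_elim simp
  qed (use pos in auto)
qed

lemma AE_dir_deriv_sum:
  assumes lip: "L-lipschitz_on UNIV f" and "finite A"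
  shows "AE x in lborel. dir_deriv f (\<Sum>b\<in>A. r b *\<^sub>R b) x = (\<Sum>b\<in>A. r b * dir_deriv f b x)"
  using \<open>finite A\<close>
proof induction
  case (insert b A)
  show ?case
    using insert.IH AE_dir_deriv_scale[OF lip, of "r b" b]
      AE_dir_deriv_add[OF lip, of "r b *\<^sub>R b" "\<Sum>b\<in>A. r b *\<^sub>R b"]
    by eventually_elim (use insert.hyps in simp)
qed simp

text \<open>Gateaux derivatives are all that is needed: linearity on a countable dense set of directions
  extends to all directions because the quotients are Lipschitz in \<open>v\<close>.\<close>

lemma rademacher:
  fixes f :: "'a::euclidean_space \<Rightarrow> real"
  assumes lip: "L-lipschitz_on UNIV f"
  obtains \<gamma> where "\<gamma> \<in> borel_measurable borel"
    "AE x in lborel. \<forall>v. (\<lambda>n. diff_quot f v n x) \<longlonglongrightarrow> \<gamma> x \<bullet> v"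
proof -
  have L0: "0 \<le> L" using lip by (rule lipschitz_on_nonneg)
  define \<gamma> where "\<gamma> x = (\<Sum>b\<in>Basis. dir_deriv f b x *\<^sub>R b)" for x
  have meas: "\<gamma> \<in> borel_measurable borel"
    unfolding \<gamma>_def using borel_measurable_dir_deriv[OF lip] by measurable
  obtain S :: "'a set" where S: "countable S" "\<And>X. open X \<Longrightarrow> X \<noteq> {} \<Longrightarrow> \<exists>d\<in>S. d \<in> X"
    using countable_dense_setE by blast
  have "AE x in lborel. \<forall>q\<in>S. (\<lambda>n. diff_quot f q n x) \<longlonglongrightarrow> \<gamma> x \<bullet> q"
  proof (subst AE_ball_countable[OF S(1)], rule ballI)
    fix q
    have \<gamma>q: "\<gamma> x \<bullet> q = (\<Sum>b\<in>Basis. (q \<bullet> b) * dir_deriv f b x)" for x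
      unfolding \<gamma>_def inner_sum_left inner_scaleR_left by (simp add: inner_commute mult.commute)
    have "AE x in lborel. dir_deriv f (\<Sum>b\<in>Basis. (q \<bullet> b) *\<^sub>R b) x = (\<Sum>b\<in>Basis. (q \<bullet> b) * dir_deriv f b x)"
      by (rule AE_dir_deriv_sum[OF lip]) simp
    then show "AE x in lborel. (\<lambda>n. diff_quot f q n x) \<longlonglongrightarrow> \<gamma> x \<bullet> q"
      using AE_diff_quot[OF lip, of q]
      by eventually_elim (simp add: euclidean_representation \<gamma>q)
  qed
  then have "AE x in lborel. \<forall>v. (\<lambda>n. diff_quot f v n x) \<longlonglongrightarrow> \<gamma> x \<bullet> v"
  proof eventually_elim
    case (elim x)
    show ?case
    proof (intro allI tendstoI)
      fix v and e :: real assume e: "0 < e"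
      \<comment> \<open>\<open>L\<close> controls the quotients and \<open>norm (\<gamma> x)\<close>
        the limit when \<open>v\<close> is replaced by \<open>q\<close>; adding 1 keeps
        \<open>M\<close> positive.\<close>
      define M where "M = L + norm (\<gamma> x) + 1"
      have M: "M > 0" using L0 by (simp add: M_def add_nonneg_pos)
      then have "0 < e / (2 * M)" using e by simp
      then obtain q where q: "q \<in> S" "dist v q < e / (2 * M)"
        using S(2)[of "ball v (e / (2 * M))"] by (metis ball_eq_empty mem_ball not_le open_ball)
      have "\<forall>\<^sub>F n in sequentially. dist (diff_quot f q n x) (\<gamma> x \<bullet> q) < e / 2"
        using elim q(1) e by (intro tendstoD) auto
      then show "\<forall>\<^sub>F n in sequentially. dist (diff_quot f v n x) (\<gamma> x \<bullet> v) < e"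
      proof eventually_elim
        case (elim n)
        have "\<bar>diff_quot f v n x - diff_quot f q n x\<bar> \<le> L * norm (v - q)"
          by (rule diff_quot_lipschitz[OF lip])
        moreover have "\<bar>\<gamma> x \<bullet> v - \<gamma> x \<bullet> q\<bar> \<le> norm (\<gamma> x) * norm (v - q)"
          by (metis Cauchy_Schwarz_ineq2 inner_diff_right)
        moreover have "(L + norm (\<gamma> x)) * norm (v - q) \<le> M * norm (v - q)"
          by (rule mult_right_mono) (simp_all add: M_def)
        moreover have "M * norm (v - q) < e / 2"
          using q(2) M by (simp add: dist_norm field_simps)
        ultimately show ?case
          using elim unfolding dist_real_def distrib_right by linarith
      qed
    qed
  qed
  with meas show ?thesis by (rule that)
qed

text \<open>On almost every segment from \<open>x\<close>, \<open>\<gamma>\<close> is the Gateaux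
  derivative at almost every parameter. There its component along the segment and the
  one-dimensional density are limits of the same quotients, so they have the same integral.\<close>

lemma lipschitz_line_integral:
  fixes f :: "'a::euclidean_space \<Rightarrow> real"
  assumes lip: "L-lipschitz_on UNIV f" and [measurable]: "\<gamma> \<in> borel_measurable borel"
    and \<gamma>: "AE x in lborel. \<forall>v. (\<lambda>n. diff_quot f v n x) \<longlonglongrightarrow> \<gamma> x \<bullet> v"
  shows "AE y in lborel. f y - f x = (LINT t:{0..1}|lborel. \<gamma> (x + t *\<^sub>R (y - x)) \<bullet> (y - x))"
  using AE_segment[OF \<gamma>, of x]
proof eventually_elim
  case (elim y)
  define v where "v = y - x"
  define \<phi> where "\<phi> t = f (x + t *\<^sub>R v)" for t
  have "(L * norm v)-lipschitz_on UNIV \<phi>" unfolding \<phi>_def by (rule lipschitz_on_line[OF lip])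
  then obtain h where [measurable]: "h \<in> borel_measurable borel"
    and h: "(LINT t:{0..1}|lborel. h t) = \<phi> 1 - \<phi> 0"
    "AE t in lborel. \<forall>c>0. (\<lambda>n. real (Suc n) * (\<phi> (t + c / real (Suc n)) - \<phi> t)) \<longlonglongrightarrow> c * h t"
    by (rule lipschitz_real_AE_derivative)
  have "AE t in lborel. \<gamma> (x + t *\<^sub>R v) \<bullet> v = h t"
    using h(2) elim
  proof eventually_elim
    case (elim t)
    have "diff_quot f v n (x + t *\<^sub>R v) = real (Suc n) * (\<phi> (t + 1 / real (Suc n)) - \<phi> t)" for n
      by (simp add: diff_quot_def \<phi>_def scaleR_add_left divide_inverse add.assoc mult.commute del: of_nat_Suc)
    then have "(\<lambda>n. diff_quot f v n (x + t *\<^sub>R v)) \<longlonglongrightarrow> h t" using elim(1)[rule_format, of 1] by simp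
    then show ?case using elim(2)[folded v_def, rule_format, of v] LIMSEQ_unique by blast
  qed
  then have "(LINT t:{0..1}|lborel. \<gamma> (x + t *\<^sub>R v) \<bullet> v) = (LINT t:{0..1}|lborel. h t)"
    by (intro set_lebesgue_integral_cong_AE) auto
  then show ?case using h(1) by (simp add: \<phi>_def v_def)
qed

section \<open>Norms, representatives and segment integrals\<close>

context
  fixes N :: "real ^ 'n \<Rightarrow> real"
  assumes N: "is_norm N"
begin

lemma is_norm_nonneg: "0 \<le> N x"
  and is_norm_eq_0: "N x = 0 \<longleftrightarrow> x = 0"
  and is_norm_scaleR: "N (c *\<^sub>R x) = \<bar>c\<bar> * N x"
  and is_norm_triangle: "N (x + y) \<le> N x + N y"
  using N unfolding is_norm_def by auto

lemma is_norm_zero: "N 0 = 0"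
  by (simp add: is_norm_eq_0)

lemma is_norm_minus: "N (- x) = N x"
  using is_norm_scaleR[of "-1" x] by simp

lemma is_norm_commute: "N (x - y) = N (y - x)"
  using is_norm_minus[of "x - y"] by simp

lemma is_norm_triangle_diff: "N (x - z) \<le> N (x - y) + N (y - z)"
  using is_norm_triangle[of "x - y" "y - z"] by simp

lemma is_norm_upper:
  obtains C where "0 \<le> C" "\<And>x. N x \<le> C * norm x"
proof
  show "0 \<le> (\<Sum>b\<in>Basis. N b)" by (intro sum_nonneg is_norm_nonneg)
  fix x :: "real ^ 'n"
  have sub: "N (\<Sum>b\<in>A. g b) \<le> (\<Sum>b\<in>A. N (g b))" if "finite A" for A and g :: "real ^ 'n \<Rightarrow> real ^ 'n"
    using that
  proof induction
    case (insert a A)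
    then show ?case using is_norm_triangle[of "g a" "\<Sum>b\<in>A. g b"] by simp
  qed (simp add: is_norm_zero)
  have "N x = N (\<Sum>b\<in>Basis. (x \<bullet> b) *\<^sub>R b)" by (simp add: euclidean_representation)
  also have "\<dots> \<le> (\<Sum>b\<in>Basis. N ((x \<bullet> b) *\<^sub>R b))" by (rule sub) simp
  also have "\<dots> \<le> (\<Sum>b\<in>Basis. norm x * N b)"
    by (intro sum_mono) (simp add: is_norm_scaleR Basis_le_norm mult_right_mono is_norm_nonneg)
  finally show "N x \<le> (\<Sum>b\<in>Basis. N b) * norm x" by (simp add: sum_distrib_left mult.commute)
qed

lemma continuous_on_is_norm: "continuous_on S N"
proof -
  obtain C where C: "0 \<le> C" "\<And>x. N x \<le> C * norm x" by (rule is_norm_upper) blast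
  have "C-lipschitz_on S N"
  proof (rule lipschitz_onI)
    fix x y
    have "\<bar>N x - N y\<bar> \<le> N (x - y)"
      using is_norm_triangle_diff[of x 0 y] is_norm_triangle_diff[of y 0 x] is_norm_commute[of x y] is_norm_minus by simp
    then show "dist (N x) (N y) \<le> C * dist x y"
      using C(2)[of "x - y"] by (simp add: dist_real_def dist_norm)
  qed (rule C)
  then show ?thesis by (rule lipschitz_on_continuous_on)
qed

lemma lipschitz_on_if_is_norm_lipschitz:
  assumes L: "0 \<le> L" and f: "\<And>x y. \<bar>f x - f y\<bar> \<le> L * N (x - y)"
  obtains L' where "L'-lipschitz_on UNIV f"
proof -
  obtain K where K: "0 \<le> K" "\<And>x. N x \<le> K * norm x" by (rule is_norm_upper) blast
  have "(L * K)-lipschitz_on UNIV f"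
  proof (rule lipschitz_onI)
    fix x y
    show "dist (f x) (f y) \<le> L * K * dist x y"
      using order_trans[OF f mult_left_mono[OF K(2) L], of x y]
      by (simp add: dist_real_def dist_norm mult.assoc)
  qed (use L K in simp)
  then show ?thesis by (rule that)
qed

lemma is_norm_lower:
  obtains c where "0 < c" "\<And>x. c * norm x \<le> N x"
proof -
  have "compact (sphere (0 :: real ^ 'n) 1)" "sphere (0 :: real ^ 'n) 1 \<noteq> {}" by auto
  from continuous_attains_inf[OF this continuous_on_is_norm]
  obtain u :: "real ^ 'n" where u: "norm u = 1" "\<And>y. norm y = 1 \<Longrightarrow> N u \<le> N y"
    by auto
  show ?thesis
  proof
    show "0 < N u" using u(1) is_norm_nonneg[of u] is_norm_eq_0[of u] by fastforce
    fix x :: "real ^ 'n"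
    show "N u * norm x \<le> N x"
    proof (cases "x = 0")
      case False
      then have "N u \<le> N (x /\<^sub>R norm x)" by (intro u) simp
      then show ?thesis using False by (simp add: is_norm_scaleR field_simps)
    qed (simp add: is_norm_zero)
  qed
qed

text \<open>The supremum is over a bounded set because \<open>N\<close> dominates a multiple of the
  Euclidean norm. All later facts about \<open>dual_norm\<close> go through this
  equivalence.\<close>

lemma dual_norm_le_iff: "dual_norm N \<phi> \<le> C \<longleftrightarrow> 0 \<le> C \<and> (\<forall>v. \<bar>blinfun_apply \<phi> v\<bar> \<le> C * N v)"
proof
  obtain c where c: "0 < c" "\<And>x. c * norm x \<le> N x" by (rule is_norm_lower) blast
  have bdd: "bdd_above ((\<lambda>v. \<bar>blinfun_apply \<phi> v\<bar>) ` {v. N v \<le> 1})"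
  proof (rule bdd_aboveI2)
    fix v assume "v \<in> {v. N v \<le> 1}"
    then have "norm v \<le> 1 / c" using c(2)[of v] c(1) by (simp add: field_simps)
    moreover have "\<bar>blinfun_apply \<phi> v\<bar> \<le> norm \<phi> * norm v" using norm_blinfun[of \<phi> v] by simp
    ultimately show "\<bar>blinfun_apply \<phi> v\<bar> \<le> norm \<phi> * (1 / c)"
      by (meson mult_left_mono norm_ge_zero order_trans)
  qed
  assume le: "dual_norm N \<phi> \<le> C"
  have ball: "\<bar>blinfun_apply \<phi> v\<bar> \<le> C" if "N v \<le> 1" for v
    using cSUP_upper[OF _ bdd, of v] that le by (simp add: dual_norm_def)
  have "0 \<le> C" using ball[of 0] by (simp add: is_norm_zero)
  moreover have "\<bar>blinfun_apply \<phi> v\<bar> \<le> C * N v" for v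
  proof (cases "v = 0")
    case False
    then have pos: "N v > 0" using is_norm_nonneg[of v] is_norm_eq_0[of v] by simp
    have "\<bar>blinfun_apply \<phi> (v /\<^sub>R N v)\<bar> \<le> C" by (rule ball) (use pos in \<open>simp add: is_norm_scaleR\<close>)
    then show ?thesis using pos by (simp add: blinfun.scaleR_right abs_mult field_simps)
  qed (simp add: is_norm_zero)
  ultimately show "0 \<le> C \<and> (\<forall>v. \<bar>blinfun_apply \<phi> v\<bar> \<le> C * N v)" by blast
next
  assume C: "0 \<le> C \<and> (\<forall>v. \<bar>blinfun_apply \<phi> v\<bar> \<le> C * N v)"
  show "dual_norm N \<phi> \<le> C" unfolding dual_norm_def
  proof (rule cSUP_least)
    show "{v. N v \<le> 1} \<noteq> {}" by (auto intro: exI[of _ 0] simp: is_norm_zero)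
    fix v assume "v \<in> {v. N v \<le> 1}"
    then show "\<bar>blinfun_apply \<phi> v\<bar> \<le> C" using C mult_left_le[of "N v" C] order_trans by fastforce
  qed
qed

text \<open>Sublevel sets are closed, being intersections of closed conditions, one for each
  \<open>v\<close>.\<close>

lemma borel_measurable_dual_norm [measurable]: "dual_norm N \<in> borel_measurable borel"
proof (rule borel_measurableI_le)
  fix C
  have "{\<phi>. dual_norm N \<phi> \<le> C} = (if 0 \<le> C then \<Inter>v. {\<phi>. \<bar>blinfun_apply \<phi> v\<bar> \<le> C * N v} else {})"
    by (auto simp: dual_norm_le_iff)
  moreover have "closed (\<Inter>v. {\<phi>. \<bar>blinfun_apply \<phi> v\<bar> \<le> C * N v})"
    by (intro closed_INT ballI closed_Collect_le continuous_intros)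
  ultimately have "closed {\<phi>. dual_norm N \<phi> \<le> C}" by simp
  then show "{\<phi> \<in> space borel. dual_norm N \<phi> \<le> C} \<in> sets borel" by (simp add: borel_closed)
qed

text \<open>Test \<open>w\<close> against itself. The Euclidean bound obtained this way gives
  integrability along segments.\<close>

lemma norm_le_if_dual_bound:
  assumes "0 \<le> C" and bound: "\<And>v. \<bar>w \<bullet> v\<bar> \<le> C * N v" and K: "\<And>x. N x \<le> K * norm x"
  shows "norm w \<le> C * K"
proof (cases "w = 0")
  case False
  have "norm w * norm w = \<bar>w \<bullet> w\<bar>" by (simp add: dot_square_norm power2_eq_square)
  also have "\<dots> \<le> C * (K * norm w)" using bound[of w] K[of w] assms(1) by (meson mult_left_mono order_trans)
  finally show ?thesis using False by simp
next
  case True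
  obtain b :: "real ^ 'n" where "b \<in> Basis" using nonempty_Basis by blast
  then have "0 \<le> K" using K[of b] is_norm_nonneg[of b] by simp
  then show ?thesis using True assms(1) by simp
qed

end

section \<open>Riesz vectors and almost everywhere statements on a domain\<close>

definition riesz :: "'n dual \<Rightarrow> real ^ 'n" where
  "riesz \<phi> = (\<Sum>b\<in>Basis. blinfun_apply \<phi> b *\<^sub>R b)"

lemma blinfun_inner_right_riesz [simp]: "blinfun_inner_right (riesz \<phi>) = \<phi>"
proof (rule blinfun_eqI)
  fix v
  have "blinfun_apply \<phi> v = blinfun_apply \<phi> (\<Sum>b\<in>Basis. (v \<bullet> b) *\<^sub>R b)"
    by (simp add: euclidean_representation)
  also have "\<dots> = (\<Sum>b\<in>Basis. (v \<bullet> b) * blinfun_apply \<phi> b)"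
    by (simp add: blinfun.sum_right blinfun.scaleR_right)
  also have "\<dots> = riesz \<phi> \<bullet> v"
    unfolding riesz_def inner_sum_left inner_scaleR_left by (simp add: inner_commute mult.commute)
  finally show "blinfun_apply (blinfun_inner_right (riesz \<phi>)) v = blinfun_apply \<phi> v" by simp
qed

lemma riesz_inner: "riesz \<phi> \<bullet> v = blinfun_apply \<phi> v"
  by (metis blinfun_inner_right_riesz blinfun_inner_right.rep_eq)

lemma borel_measurable_riesz [measurable]: "riesz \<in> borel_measurable borel"
  unfolding riesz_def by (intro borel_measurable_continuous_onI continuous_intros)

lemma borel_measurable_blinfun_inner_right [measurable]:
  "(blinfun_inner_right :: real ^ 'n \<Rightarrow> 'n dual) \<in> borel_measurable borel"
  by (intro borel_measurable_continuous_onI linear_continuous_on bounded_linear_blinfun_inner_right)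

lemma AE_lebesgue_on_iff:
  assumes "U \<in> sets borel"
  shows "(AE x in lebesgue_on U. P x) \<longleftrightarrow> (AE x in lborel. x \<in> U \<longrightarrow> P x)"
  by (subst AE_restrict_space_iff) (use assms in \<open>auto simp: AE_completion_iff\<close>)

lemma sigma_finite_lebesgue_on:
  fixes U :: "'a::euclidean_space set"
  assumes "U \<in> sets borel"
  shows "sigma_finite_measure (lebesgue_on U)"
proof (rule sigma_finite_measure_restrict_space)
  obtain A :: "'a set set" where "countable A" "A \<subseteq> sets lborel" "\<Union>A = space lborel" "\<forall>a\<in>A. emeasure lborel a \<noteq> \<infinity>"
    using lborel.sigma_finite_countable by blast
  then show "sigma_finite_measure (lebesgue :: 'a measure)"
    by (intro sigma_finite_measure.intro exI[of _ A]) (auto simp: subset_eq)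
qed (use assms in auto)

text \<open>Completion happens in each factor before the product is formed. A null set of the Borel
  product is therefore pulled back along the identity, to make it measurable, and then shown to be
  null slice by slice.\<close>

lemma AE_pair_lebesgue_onI:
  fixes U :: "'a::euclidean_space set"
  assumes U: "U \<in> sets borel"
    and ae: "AE w in lborel \<Otimes>\<^sub>M lborel. fst w \<in> U \<longrightarrow> snd w \<in> U \<longrightarrow> P w"
  shows "AE w in lebesgue_on U \<Otimes>\<^sub>M lebesgue_on U. P w"
proof -
  interpret S: sigma_finite_measure "lebesgue_on U" by (rule sigma_finite_lebesgue_on[OF U])
  interpret pair_sigma_finite "lebesgue_on U" "lebesgue_on U" ..
  obtain Z where Z: "Z \<in> null_sets (lborel \<Otimes>\<^sub>M lborel)"
    "\<And>w. w \<notin> Z \<Longrightarrow> fst w \<in> U \<longrightarrow> snd w \<in> U \<longrightarrow> P w"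
    using ae unfolding eventually_ae_filter by (auto simp: space_pair_measure)
  have id: "(\<lambda>x. x) \<in> measurable (lebesgue_on U) lborel"
    by (rule measurable_restrict_space1) (simp add: measurable_completion)
  have [measurable]: "fst \<in> measurable (lebesgue_on U \<Otimes>\<^sub>M lebesgue_on U) lborel"
    "snd \<in> measurable (lebesgue_on U \<Otimes>\<^sub>M lebesgue_on U) lborel"
    using measurable_compose[OF measurable_fst id] measurable_compose[OF measurable_snd id] by simp_all
  have "(\<lambda>w. (fst w, snd w)) \<in> measurable (lebesgue_on U \<Otimes>\<^sub>M lebesgue_on U) (lborel \<Otimes>\<^sub>M lborel)"
    by (rule measurable_Pair) measurable
  then have "(\<lambda>w. w) \<in> measurable (lebesgue_on U \<Otimes>\<^sub>M lebesgue_on U) (lborel \<Otimes>\<^sub>M lborel)" by simp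
  from measurable_sets[OF this, of Z] Z(1)
  have "{w \<in> space (lebesgue_on U \<Otimes>\<^sub>M lebesgue_on U). w \<in> Z} \<in> sets (lebesgue_on U \<Otimes>\<^sub>M lebesgue_on U)"
    by (simp add: null_sets_def Int_def conj_commute)
  then have "AE w in lebesgue_on U \<Otimes>\<^sub>M lebesgue_on U. w \<notin> Z"
  proof (intro AE_pair_measure)
    assume m: "{w \<in> space (lebesgue_on U \<Otimes>\<^sub>M lebesgue_on U). w \<in> Z} \<in> sets (lebesgue_on U \<Otimes>\<^sub>M lebesgue_on U)"
    from sets.sets_Collect_neg[OF m]
    show "{w \<in> space (lebesgue_on U \<Otimes>\<^sub>M lebesgue_on U). w \<notin> Z} \<in> sets (lebesgue_on U \<Otimes>\<^sub>M lebesgue_on U)" .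
    have "AE x in lborel. AE y in lborel. (x, y) \<notin> Z"
      by (rule lborel_pair.AE_pair[OF AE_not_in[OF Z(1)]])
    then show "AE x in lebesgue_on U. AE y in lebesgue_on U. (x, y) \<notin> Z"
      unfolding AE_lebesgue_on_iff[OF U] by (auto elim!: eventually_mono)
  qed
  moreover have "AE w in lebesgue_on U \<Otimes>\<^sub>M lebesgue_on U. fst w \<in> U \<and> snd w \<in> U"
    by (rule AE_I2) (auto simp: space_pair_measure space_restrict_space)
  ultimately show ?thesis by eventually_elim (use Z(2) in blast)
qed

lemma AE_pair_lebesgue_onD:
  fixes U :: "'a::euclidean_space set"
  assumes U: "U \<in> sets borel" and ae: "AE w in lebesgue_on U \<Otimes>\<^sub>M lebesgue_on U. P w"
  shows "AE x in lborel. x \<in> U \<longrightarrow> (AE y in lborel. y \<in> U \<longrightarrow> P (x, y))"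
proof -
  interpret S: sigma_finite_measure "lebesgue_on U" by (rule sigma_finite_lebesgue_on[OF U])
  interpret pair_sigma_finite "lebesgue_on U" "lebesgue_on U" ..
  show ?thesis using AE_pair[OF ae] unfolding AE_lebesgue_on_iff[OF U] .
qed

lemma AE_pair_fst_snd:
  assumes ae: "AE x in (lborel :: 'a::euclidean_space measure). P x"
  shows "AE w in lborel \<Otimes>\<^sub>M lborel. P (fst w) \<and> P (snd w)"
proof -
  obtain Z where Z: "Z \<in> null_sets lborel" "\<And>x. x \<notin> Z \<Longrightarrow> P x"
    by (rule AE_lborelE[OF ae]) blast
  then have [measurable]: "Z \<in> sets borel" by auto
  have "AE w in lborel \<Otimes>\<^sub>M lborel. fst w \<notin> Z \<and> snd w \<notin> Z"
  proof (rule lborel_pair.AE_pair_measure)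
    have nz: "AE x in lborel. x \<notin> Z" by (rule AE_not_in[OF Z(1)])
    then show "AE x in lborel. AE y in lborel. fst (x, y) \<notin> Z \<and> snd (x, y) \<notin> Z"
    proof eventually_elim
      case (elim x)
      show ?case using nz by eventually_elim (simp add: elim)
    qed
  qed measurable
  then show ?thesis by (rule eventually_mono) (auto intro: Z)
qed

section \<open>Segment integrals of bounded Borel fields\<close>

definition line_integral :: "(real ^ 'n \<Rightarrow> real ^ 'n) \<Rightarrow> real ^ 'n \<Rightarrow> real ^ 'n \<Rightarrow> real" where
  "line_integral \<gamma> x y = (LINT t:{0..1}|lborel. \<gamma> (x + t *\<^sub>R (y - x)) \<bullet> (y - x))"

lemma set_integrable_line:
  fixes \<gamma> :: "real ^ 'n \<Rightarrow> real ^ 'n"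
  assumes [measurable]: "\<gamma> \<in> borel_measurable borel" and B: "\<And>x. norm (\<gamma> x) \<le> B"
  shows "set_integrable lborel {a..b} (\<lambda>t. \<gamma> (x + t *\<^sub>R v) \<bullet> v)"
  unfolding set_integrable_def
proof (rule integrableI_bounded_set_indicator[where B="B * norm v"])
  have "norm (\<gamma> z \<bullet> v) \<le> B * norm v" for z
    using Cauchy_Schwarz_ineq2[of "\<gamma> z" v] mult_right_mono[OF B[of z], of "norm v"] by simp
  then show "AE t in lborel. t \<in> {a..b} \<longrightarrow> norm (\<gamma> (x + t *\<^sub>R v) \<bullet> v) \<le> B * norm v" by simp
qed (auto simp: emeasure_lborel_Icc_eq)

lemma borel_measurable_line_integral:
  fixes \<gamma> :: "real ^ 'n \<Rightarrow> real ^ 'n"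
  assumes [measurable]: "\<gamma> \<in> borel_measurable borel"
  shows "(\<lambda>w. line_integral \<gamma> (fst w) (snd w)) \<in> borel_measurable (lborel \<Otimes>\<^sub>M lborel)"
  unfolding line_integral_def set_lebesgue_integral_def by measurable

lemma measurable_lebesgue_AE:
  fixes h :: "'a::euclidean_space \<Rightarrow> 'b::topological_space"
  assumes h: "h \<in> borel_measurable borel" and ae: "AE x in lborel. k x = h x"
  shows "k \<in> borel_measurable lebesgue"
proof (rule measurableI)
  fix A :: "'b set" assume "A \<in> sets borel"
  then have hA: "h -` A \<in> sets lebesgue" using measurable_sets[OF h, of A] by auto
  have "AE x in lebesgue. x \<in> h -` A \<longleftrightarrow> x \<in> k -` A"
    unfolding AE_completion_iff using ae by eventually_elim simp
  from completion.in_sets_AE[OF this hA] show "k -` A \<inter> space lebesgue \<in> sets lebesgue" by simp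
qed simp

text \<open>The default value of \<open>T_op\<close> is excluded here. Even measurability of
  \<open>g\<close> along the segment comes only from its agreement almost everywhere with a bounded
  Borel integrand, by completeness of Lebesgue measure.\<close>

lemma T_op_eq_line_integral:
  fixes \<gamma> :: "real ^ 'n \<Rightarrow> real ^ 'n"
  assumes [measurable]: "\<gamma> \<in> borel_measurable borel" and B: "\<And>x. norm (\<gamma> x) \<le> B"
    and ae: "AE t in lborel. t \<in> {0..1} \<longrightarrow>
      g (x + t *\<^sub>R (y - x)) = blinfun_inner_right (\<gamma> (x + t *\<^sub>R (y - x)))"
  shows "T_op x g y = line_integral \<gamma> x y"
proof -
  define F where "F t = blinfun_apply (g (x + t *\<^sub>R (y - x))) (y - x)" for t
  define H where "H t = indicator {0..1} t *\<^sub>R (\<gamma> (x + t *\<^sub>R (y - x)) \<bullet> (y - x))" for t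
  have H_meas[measurable]: "H \<in> borel_measurable borel" unfolding H_def by measurable
  have H_int: "integrable lborel H"
    using set_integrable_line[OF assms(1) B, of 0 1 x "y - x"]
    unfolding set_integrable_def H_def .
  have eq: "AE t in lborel. indicator {0..1} t *\<^sub>R F t = H t"
    using ae by eventually_elim (auto simp: F_def H_def indicator_def)
  have F_meas: "(\<lambda>t. indicator {0..1} t *\<^sub>R F t) \<in> borel_measurable lebesgue"
    using H_meas eq by (rule measurable_lebesgue_AE)
  have H_leb: "integrable lebesgue H" "integral\<^sup>L lebesgue H = integral\<^sup>L lborel H" "H \<in> borel_measurable lebesgue"
    using H_int integrable_completion[of H lborel] integral_completion[of H lborel] by auto
  have eq': "AE t in lebesgue. indicator {0..1} t *\<^sub>R F t = H t"
    using eq by (simp add: AE_completion_iff)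
  have "integrable (lebesgue_on {0..1}) F"
    by (subst integrable_restrict_space)
      (use integrable_cong_AE[OF F_meas H_leb(3) eq'] H_leb(1) in simp_all)
  moreover have "integral\<^sup>L (lebesgue_on {0..1}) F = integral\<^sup>L lborel H"
    by (subst integral_restrict_space)
      (use integral_cong_AE[OF F_meas H_leb(3) eq'] H_leb(2) in simp_all)
  moreover have "integral\<^sup>L lborel H = line_integral \<gamma> x y"
    by (simp add: H_def[abs_def] line_integral_def set_lebesgue_integral_def)
  moreover have "T_op x g y = (if integrable (lebesgue_on {0..1}) F then integral\<^sup>L (lebesgue_on {0..1}) F else 0)"
    by (simp add: T_op_def F_def[abs_def] Let_def)
  ultimately show ?thesis by simp
qed

lemma segment_mem:
  assumes "convex U" "x \<in> U" "y \<in> U" "t \<in> {0..1::real}"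
  shows "x + t *\<^sub>R (y - x) \<in> U"
proof -
  have "x + t *\<^sub>R (y - x) = (1 - t) *\<^sub>R x + t *\<^sub>R y" by (simp add: algebra_simps)
  then show ?thesis using convexD_alt[OF assms(1-3), of t] assms(4) by simp
qed

lemma borel_inner_bound_set: "{w :: 'a::euclidean_space. \<forall>v. \<bar>w \<bullet> v\<bar> \<le> C * N v} \<in> sets borel"
proof -
  have "{w. \<forall>v. \<bar>w \<bullet> v\<bar> \<le> C * N v} = (\<Inter>v. {w. \<bar>w \<bullet> v\<bar> \<le> C * N v})" by auto
  also have "closed \<dots>" by (intro closed_INT ballI closed_Collect_le continuous_intros)
  finally show ?thesis by (rule borel_closed)
qed

text \<open>A Borel version is chosen for each component of the Riesz vector. Having the bound at
  every point, not just almost everywhere, makes it valid on every segment.\<close>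

lemma Linf_fun_representative:
  fixes U :: "(real ^ 'n) set"
  assumes N: "is_norm N" and U: "U \<in> sets borel" and C: "0 \<le> C"
    and g: "g \<in> Linf_fun N U" and bound: "AE x in lebesgue_on U. dual_norm N (g x) \<le> C"
  obtains \<gamma> where "\<gamma> \<in> borel_measurable borel" "\<And>x v. \<bar>\<gamma> x \<bullet> v\<bar> \<le> C * N v"
    "AE x in lebesgue_on U. g x = blinfun_inner_right (\<gamma> x)"
proof -
  have [measurable]: "g \<in> borel_measurable (lebesgue_on U)" using g by (simp add: Linf_fun_def)
  define G where "G x = (if x \<in> U then riesz (g x) else 0)" for x
  have "(\<lambda>x. riesz (g x)) \<in> borel_measurable (lebesgue_on U)" by measurable
  then have [measurable]: "G \<in> borel_measurable lebesgue"
    unfolding G_def by (subst (asm) measurable_restrict_space_iff[where c=0]) (use U in auto)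
  have "\<exists>k\<in>borel_measurable lborel. AE x in lborel. G x \<bullet> b = k x" for b
    by (rule completion_ex_borel_measurable_real) measurable
  then have "\<forall>b. \<exists>k. k \<in> borel_measurable borel \<and> (AE x in lborel. G x \<bullet> b = k x)" by auto
  from choice[OF this] obtain k where
    k: "\<And>b. k b \<in> borel_measurable borel" "\<And>b. AE x in lborel. G x \<bullet> b = k b x"
    by blast
  define K where "K = {w. \<forall>v. \<bar>w \<bullet> v\<bar> \<le> C * N v}"
  have [measurable]: "K \<in> sets borel" unfolding K_def by (rule borel_inner_bound_set)
  define \<gamma>0 where "\<gamma>0 x = (\<Sum>b\<in>Basis. k b x *\<^sub>R b)" for x
  have [measurable]: "\<gamma>0 \<in> borel_measurable borel" unfolding \<gamma>0_def using k(1) by measurable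
  \<comment> \<open>Values outside the dual ball \<open>K\<close> of radius \<open>C\<close> are
    reset to 0, which lies in \<open>K\<close>; inside \<open>U\<close> this happens only on a null
    set.\<close>
  define \<gamma> where "\<gamma> x = (if \<gamma>0 x \<in> K then \<gamma>0 x else 0)" for x
  show ?thesis
  proof
    show "\<gamma> \<in> borel_measurable borel" unfolding \<gamma>_def by measurable
    show "\<bar>\<gamma> x \<bullet> v\<bar> \<le> C * N v" for x v
      using C is_norm_nonneg[OF N, of v] by (auto simp: \<gamma>_def K_def)
    have "AE x in lborel. \<forall>b\<in>Basis. G x \<bullet> b = k b x"
      using k(2) by (subst AE_ball_countable) (auto simp: countable_finite)
    then have "AE x in lborel. G x = \<gamma>0 x"
    proof eventually_elim
      case (elim x)
      have "\<gamma>0 x = (\<Sum>b\<in>Basis. (G x \<bullet> b) *\<^sub>R b)"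
        unfolding \<gamma>0_def by (rule sum.cong) (use elim in auto)
      then show ?case by (simp add: euclidean_representation)
    qed
    then show "AE x in lebesgue_on U. g x = blinfun_inner_right (\<gamma> x)"
      using bound unfolding AE_lebesgue_on_iff[OF U]
    proof eventually_elim
      case (elim x)
      then have "\<gamma>0 x \<in> K" if "x \<in> U"
        using that dual_norm_le_iff[OF N, of "g x" C] by (auto simp: G_def K_def riesz_inner simp flip: elim(1))
      then show ?case using elim(1) by (auto simp: G_def \<gamma>_def simp flip: elim(1))
    qed
  qed
qed

text \<open>The first form handles the fixed base point 0, which statements about almost all pairs
  do not see; the second handles the right-hand side of compatibility. Convexity keeps the segments
  where \<open>g\<close> and \<open>\<gamma>\<close> are compared.\<close>

lemma T_op_AE:
  fixes U :: "(real ^ 'n) set"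
  assumes U: "U \<in> sets borel" "convex U"
    and \<gamma>: "\<gamma> \<in> borel_measurable borel" "\<And>x. norm (\<gamma> x) \<le> B"
    and ae: "AE x in lebesgue_on U. g x = blinfun_inner_right (\<gamma> x)"
  shows "x \<in> U \<Longrightarrow> AE y in lborel. y \<in> U \<longrightarrow> T_op x g y = line_integral \<gamma> x y"
    and "AE w in lborel \<Otimes>\<^sub>M lborel. fst w \<in> U \<longrightarrow> snd w \<in> U \<longrightarrow>
      T_op (fst w) g (snd w) = line_integral \<gamma> (fst w) (snd w)"
proof -
  note ae' = ae[unfolded AE_lebesgue_on_iff[OF U(1)]]
  show "AE y in lborel. y \<in> U \<longrightarrow> T_op x g y = line_integral \<gamma> x y" if "x \<in> U"
    using AE_segment[OF ae', of x]
  proof eventually_elim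
    case (elim y)
    show ?case
    proof
      assume "y \<in> U"
      have "AE t in lborel. t \<in> {0..1} \<longrightarrow>
          g (x + t *\<^sub>R (y - x)) = blinfun_inner_right (\<gamma> (x + t *\<^sub>R (y - x)))"
        using elim by eventually_elim (use segment_mem[OF U(2) \<open>x \<in> U\<close> \<open>y \<in> U\<close>] in blast)
      then show "T_op x g y = line_integral \<gamma> x y" by (rule T_op_eq_line_integral[OF \<gamma>])
    qed
  qed
  show "AE w in lborel \<Otimes>\<^sub>M lborel. fst w \<in> U \<longrightarrow> snd w \<in> U \<longrightarrow>
      T_op (fst w) g (snd w) = line_integral \<gamma> (fst w) (snd w)"
    using AE_pair_segment[OF ae']
  proof eventually_elim
    case (elim w)
    show ?case
    proof (intro impI)
      assume w: "fst w \<in> U" "snd w \<in> U"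
      have "AE t in lborel. t \<in> {0..1} \<longrightarrow>
          g (fst w + t *\<^sub>R (snd w - fst w)) = blinfun_inner_right (\<gamma> (fst w + t *\<^sub>R (snd w - fst w)))"
        using elim by eventually_elim (use segment_mem[OF U(2) w] in blast)
      then show "T_op (fst w) g (snd w) = line_integral \<gamma> (fst w) (snd w)"
        by (rule T_op_eq_line_integral[OF \<gamma>])
    qed
  qed
qed

section \<open>Uniqueness of the gradient and Lipschitz extension\<close>

lemma AE_lborel_open_ex:
  fixes S :: "'a::euclidean_space set"
  assumes "AE x in lborel. P x" "open S" "S \<noteq> {}"
  obtains x where "x \<in> S" "P x"
proof (rule ccontr)
  note obt = that
  assume no_thesis: "\<not> thesis"
  have no: "\<not> P x" if "x \<in> S" for x using obt[OF that] no_thesis by blast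
  obtain Z where Z: "Z \<in> null_sets lborel" "\<And>x. x \<notin> Z \<Longrightarrow> P x"
    by (rule AE_lborelE[OF assms(1)]) blast
  have "negligible Z" using Z(1) by (simp add: negligible_iff_null_sets null_sets_completionI)
  moreover have "S \<subseteq> Z" using no Z(2) by blast
  ultimately show False using open_not_negligible[OF assms(2,3)] negligible_subset by blast
qed

text \<open>The factor \<open>s\<close> in the displacement is the Jacobian of the substitution that
  stretches \<open>{0..1}\<close> to \<open>{0..s}\<close>.\<close>

lemma line_integral_scaled:
  fixes \<delta> :: "real ^ 'n \<Rightarrow> real ^ 'n"
  assumes "0 < s"
  shows "line_integral \<delta> x (x + s *\<^sub>R v) = (LINT t:{0..s}|lborel. \<delta> (x + t *\<^sub>R v) \<bullet> v)"
proof -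
  have ind: "indicator {0..s} (t * s) = (indicator {0..1} t :: real)" for t
    using assms by (auto simp: indicator_def zero_le_mult_iff mult_le_cancel_right1)
  have "line_integral \<delta> x (x + s *\<^sub>R v)
      = (\<integral>t. s * (indicator {0..s} (0 + s * t) *\<^sub>R (\<delta> (x + (0 + s * t) *\<^sub>R v) \<bullet> v)) \<partial>lborel)"
    unfolding line_integral_def set_lebesgue_integral_def
    by (intro Bochner_Integration.integral_cong refl) (simp add: ind mult_ac)
  also have "\<dots> = s * (\<integral>t. indicator {0..s} (0 + s * t) *\<^sub>R (\<delta> (x + (0 + s * t) *\<^sub>R v) \<bullet> v) \<partial>lborel)"
    by (rule integral_mult_right_zero)
  also have "\<dots> = (LINT t:{0..s}|lborel. \<delta> (x + t *\<^sub>R v) \<bullet> v)"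
    using lborel_integral_real_affine[of s "\<lambda>t. indicator {0..s} t *\<^sub>R (\<delta> (x + t *\<^sub>R v) \<bullet> v)" 0] assms
    by (simp add: set_lebesgue_integral_def)
  finally show ?thesis .
qed

text \<open>Only rational \<open>s\<close> are assumed, so that a caller can unite countably many
  null sets. Continuity of the indefinite integral recovers all \<open>s\<close>, hence all
  subintervals, and these are the boxes of the line.\<close>

lemma AE_zero_if_initial_integrals_zero:
  fixes k :: "real \<Rightarrow> real"
  assumes [measurable]: "k \<in> borel_measurable borel" and B: "\<And>t. \<bar>k t\<bar> \<le> B"
    and zero: "\<And>s. s \<in> \<rat> \<Longrightarrow> 0 < s \<Longrightarrow> s \<le> 1 \<Longrightarrow> (LINT t:{0..s}|lborel. k t) = 0"
  shows "AE t in lborel. t \<in> {0<..<1} \<longrightarrow> k t = 0"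
proof -
  have int: "set_integrable lborel S k" if "S \<in> sets borel" "S \<subseteq> {0..1}" for S
    unfolding set_integrable_def
  proof (rule integrableI_bounded_set_indicator[where B=B])
    show "emeasure lborel S < \<infinity>"
      using emeasure_mono[OF that(2), of lborel] by (simp add: order_le_less_trans)
  qed (use that B in auto)
  define \<Phi> where "\<Phi> s = integral {0..s} k" for s
  have k_on: "k integrable_on {0..1}"
    using set_borel_integral_eq_integral(1)[OF int[of "{0..1}"]] by simp
  have \<Phi>_cont: "continuous_on {0..1} \<Phi>"
    unfolding \<Phi>_def by (rule indefinite_integral_continuous_1[OF k_on])
  have rat: "\<Phi> s = 0" if "s \<in> \<rat>" "0 < s" "s \<le> 1" for s
    using zero[OF that] set_borel_integral_eq_integral(2)[OF int[of "{0..s}"]] that by (simp add: \<Phi>_def)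
  have \<Phi>_zero: "\<Phi> s = 0" if s: "s \<in> {0..1}" for s
  proof -
    let ?S = "{0<..<1::real} \<inter> \<rat>"
    consider "s = 0" | "s = 1" | "s \<in> {0<..<1}" using s by force
    then show ?thesis
    proof cases
      case 3
      have "closure ?S \<subseteq> {0..1}" by (rule closure_minimal) auto
      then have cont: "continuous_on (closure ?S) \<Phi>" using \<Phi>_cont continuous_on_subset by blast
      have "s \<in> closure ?S"
        using open_Int_closure_subset[of "{0<..<1::real}" "\<rat>"] 3 by (auto simp: Rats_closure_real)
      then show ?thesis by (rule continuous_constant_on_closure[OF cont, rotated]) (simp add: rat)
    qed (use rat[of 1] in \<open>auto simp: \<Phi>_def\<close>)
  qed
  have "AE t in lborel. indicator {0<..<1} t * k t = 0"
  proof (rule AE_zero_if_box_integrals_zero[where C=B])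
    show "AE t in lborel. \<bar>indicator {0<..<1} t * k t\<bar> \<le> B"
      using B order_trans[OF abs_ge_zero B] by (auto simp: indicator_def)
    fix a b :: real
    define c d where "c = max a 0" and "d = min b 1"
    have "indicator (box a b) t *\<^sub>R (indicator {0<..<1} t * k t) = indicator {c<..<d} t *\<^sub>R k t" for t
      by (auto simp: indicator_def c_def d_def)
    then have "(LINT t:box a b|lborel. indicator {0<..<1} t * k t) = (LINT t:{c<..<d}|lborel. k t)"
      unfolding set_lebesgue_integral_def by (intro Bochner_Integration.integral_cong refl)
    also have "\<dots> = 0"
    proof (cases "c < d")
      case True
      have cd: "0 \<le> c" "d \<le> 1" by (auto simp: c_def d_def)
      have sub: "{c<..<d} \<subseteq> {0..1}" using cd by auto
      have "(LINT t:{c<..<d}|lborel. k t) = integral {c..d} k"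
        using set_borel_integral_eq_integral(2)[OF int[OF _ sub]] by (simp add: integral_open_interval_real)
      moreover have "\<Phi> c + integral {c..d} k = \<Phi> d"
        unfolding \<Phi>_def using cd True
        by (intro Henstock_Kurzweil_Integration.integral_combine integrable_on_subinterval[OF k_on]) auto
      ultimately show ?thesis using \<Phi>_zero cd True by simp
    qed (simp add: set_lebesgue_integral_def)
    finally show "(LINT t:box a b|lborel. indicator {0<..<1} t * k t) = 0" .
  qed measurable
  then show ?thesis by eventually_elim (auto simp: indicator_def)
qed

text \<open>Shrinking the end point towards \<open>x\<close> shows that the integrals over all initial pieces of the
  segment vanish, hence so does the integrand along almost every ray. A point \<open>z\<close> is then reached
  as \<open>x + t (y - x)\<close> with \<open>y\<close> in \<open>U\<close> and \<open>t\<close> close to 1.\<close>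

lemma line_integral_zero_imp_radial_zero:
  fixes \<delta> :: "real ^ 'n \<Rightarrow> real ^ 'n"
  assumes U: "open U" "convex U" "x \<in> U"
    and [measurable]: "\<delta> \<in> borel_measurable borel" and B: "\<And>z. norm (\<delta> z) \<le> B"
    and zero: "AE y in lborel. y \<in> U \<longrightarrow> line_integral \<delta> x y = 0"
  shows "AE z in lborel. z \<in> U \<longrightarrow> \<delta> z \<bullet> (z - x) = 0"
proof -
  have [measurable]: "U \<in> sets borel" using U(1) by simp
  have scaled: "AE y in lborel. y \<in> U \<longrightarrow> line_integral \<delta> x (x + s *\<^sub>R (y - x)) = 0"
    if "0 < s" "s \<le> 1" for s
  proof -
    have "(1 - s) *\<^sub>R x + s *\<^sub>R y = x + s *\<^sub>R (y - x)" for y by (simp add: algebra_simps)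
    then have "AE y in lborel. x + s *\<^sub>R (y - x) \<in> U \<longrightarrow> line_integral \<delta> x (x + s *\<^sub>R (y - x)) = 0"
      using AE_lborel_affine[OF zero, of s "(1 - s) *\<^sub>R x"] that by simp
    then show ?thesis by eventually_elim (use segment_mem[OF U(2,3)] that in auto)
  qed
  have "AE y in lborel. \<forall>s\<in>\<rat> \<inter> {0<..1}. y \<in> U \<longrightarrow> line_integral \<delta> x (x + s *\<^sub>R (y - x)) = 0"
    by (subst AE_ball_countable) (use scaled countable_rat in auto)
  then have "AE y in lborel. AE t in lborel. y \<in> U \<longrightarrow> t \<in> {0<..<1} \<longrightarrow> \<delta> (x + t *\<^sub>R (y - x)) \<bullet> (y - x) = 0"
  proof eventually_elim
    case (elim y)
    show ?case
    proof (cases "y \<in> U")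
      case True
      have "AE t in lborel. t \<in> {0<..<1} \<longrightarrow> \<delta> (x + t *\<^sub>R (y - x)) \<bullet> (y - x) = 0"
      proof (rule AE_zero_if_initial_integrals_zero)
        show "\<bar>\<delta> (x + t *\<^sub>R (y - x)) \<bullet> (y - x)\<bar> \<le> B * norm (y - x)" for t
          using Cauchy_Schwarz_ineq2 mult_right_mono[OF B norm_ge_zero] by (rule order_trans)
        show "(LINT t:{0..s}|lborel. \<delta> (x + t *\<^sub>R (y - x)) \<bullet> (y - x)) = 0"
          if "s \<in> \<rat>" "0 < s" "s \<le> 1" for s
          using elim that True line_integral_scaled[of s \<delta> x "y - x"] by simp
      qed measurable
      then show ?thesis by eventually_elim simp
    qed simp
  qed
  moreover have "{w \<in> space (lborel \<Otimes>\<^sub>M lborel). fst w \<in> U \<longrightarrow> snd w \<in> {0<..<1} \<longrightarrow>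
      \<delta> (x + snd w *\<^sub>R (fst w - x)) \<bullet> (fst w - x) = 0} \<in> sets ((lborel :: (real ^ 'n) measure) \<Otimes>\<^sub>M (lborel :: real measure))"
    by measurable
  ultimately have "AE t in lborel. AE y in lborel. y \<in> U \<longrightarrow> t \<in> {0<..<1} \<longrightarrow> \<delta> (x + t *\<^sub>R (y - x)) \<bullet> (y - x) = 0"
    by (subst (asm) lborel_pair.AE_commute)
  \<comment> \<open>For fixed \<open>t\<close>, substitute
    \<open>z = x + t *\<^sub>R (y - x)\<close>. The factor \<open>1 / t\<close> left in the inner
    product is nonzero and drops out.\<close>
  then have "AE t in lborel. AE z in lborel. x + (1 / t) *\<^sub>R (z - x) \<in> U \<longrightarrow> t \<in> {0<..<1} \<longrightarrow> \<delta> z \<bullet> (z - x) = 0"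
  proof eventually_elim
    case (elim t)
    show ?case
    proof (cases "t \<in> {0<..<1}")
      case True
      have eq: "(1 - 1 / t) *\<^sub>R x + (1 / t) *\<^sub>R z = x + (1 / t) *\<^sub>R (z - x)" for z by (simp add: algebra_simps)
      have "AE z in lborel. x + (1 / t) *\<^sub>R (z - x) \<in> U \<longrightarrow> t \<in> {0<..<1} \<longrightarrow>
          \<delta> (x + t *\<^sub>R (x + (1 / t) *\<^sub>R (z - x) - x)) \<bullet> (x + (1 / t) *\<^sub>R (z - x) - x) = 0"
        using AE_lborel_affine[OF elim, of "1 / t" "(1 - 1 / t) *\<^sub>R x"] True unfolding eq by simp
      then show ?thesis by eventually_elim (use True in auto)
    next
      case False
      then show ?thesis by (intro AE_I2) blast
    qed
  qed
  moreover have "{w \<in> space (lborel \<Otimes>\<^sub>M lborel). x + (1 / fst w) *\<^sub>R (snd w - x) \<in> U \<longrightarrow> fst w \<in> {0<..<1} \<longrightarrow>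
      \<delta> (snd w) \<bullet> (snd w - x) = 0} \<in> sets ((lborel :: real measure) \<Otimes>\<^sub>M (lborel :: (real ^ 'n) measure))"
    by measurable
  ultimately have "AE z in lborel. AE t in lborel. x + (1 / t) *\<^sub>R (z - x) \<in> U \<longrightarrow> t \<in> {0<..<1} \<longrightarrow> \<delta> z \<bullet> (z - x) = 0"
    by (subst (asm) lborel_pair.AE_commute)
  then show ?thesis
  proof eventually_elim
    case (elim z)
    show ?case
    proof
      assume "z \<in> U"
      have "((\<lambda>t. x + (1 / t) *\<^sub>R (z - x)) \<longlongrightarrow> x + (1 / 1) *\<^sub>R (z - x)) (at_left 1)"
        by (intro tendsto_intros) simp
      then have "\<forall>\<^sub>F t in at_left 1. x + (1 / t) *\<^sub>R (z - x) \<in> U"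
        using topological_tendstoD[OF _ U(1)] \<open>z \<in> U\<close> by simp
      then obtain b where b: "b < 1" "\<And>t. b < t \<Longrightarrow> t < 1 \<Longrightarrow> x + (1 / t) *\<^sub>R (z - x) \<in> U"
        unfolding eventually_at_left_field by blast
      have "{max b 0<..<1} \<noteq> {}" using b(1) by auto
      then obtain t where "t \<in> {max b 0<..<1}"
        "x + (1 / t) *\<^sub>R (z - x) \<in> U \<longrightarrow> t \<in> {0<..<1} \<longrightarrow> \<delta> z \<bullet> (z - x) = 0"
        by (rule AE_lborel_open_ex[OF elim open_greaterThanLessThan])
      then show "\<delta> z \<bullet> (z - x) = 0" using b(2)[of t] by auto
    qed
  qed
qed

text \<open>For almost every \<open>z\<close>, \<open>\<delta> z\<close> is orthogonal to
  \<open>z - x\<close> for almost every \<open>x\<close> in \<open>U\<close>. A nonzero vector fails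
  this on a nonempty open set of \<open>x\<close>.\<close>

lemma line_integral_zero_imp_zero:
  fixes \<delta> :: "real ^ 'n \<Rightarrow> real ^ 'n"
  assumes U: "open U" "convex U"
    and [measurable]: "\<delta> \<in> borel_measurable borel" and B: "\<And>z. norm (\<delta> z) \<le> B"
    and zero: "AE x in lborel. x \<in> U \<longrightarrow> (AE y in lborel. y \<in> U \<longrightarrow> line_integral \<delta> x y = 0)"
  shows "AE z in lborel. z \<in> U \<longrightarrow> \<delta> z = 0"
proof -
  have [measurable]: "U \<in> sets borel" using U(1) by simp
  have "AE x in lborel. AE z in lborel. x \<in> U \<longrightarrow> z \<in> U \<longrightarrow> \<delta> z \<bullet> (z - x) = 0"
    using zero
  proof eventually_elim
    case (elim x)
    then show ?case
      using line_integral_zero_imp_radial_zero[OF U _ assms(3) B] by (cases "x \<in> U") auto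
  qed
  moreover have "{w \<in> space (lborel \<Otimes>\<^sub>M lborel). fst w \<in> U \<longrightarrow> snd w \<in> U \<longrightarrow> \<delta> (snd w) \<bullet> (snd w - fst w) = 0}
      \<in> sets ((lborel :: (real ^ 'n) measure) \<Otimes>\<^sub>M (lborel :: (real ^ 'n) measure))"
    by measurable
  ultimately have "AE z in lborel. AE x in lborel. x \<in> U \<longrightarrow> z \<in> U \<longrightarrow> \<delta> z \<bullet> (z - x) = 0"
    by (subst (asm) lborel_pair.AE_commute)
  then show ?thesis
  proof eventually_elim
    case (elim z)
    show ?case
    proof (intro impI, rule ccontr)
      assume "z \<in> U" "\<delta> z \<noteq> 0"
      let ?S = "U \<inter> {x. \<delta> z \<bullet> (z - x) \<noteq> 0}"
      have "open ?S" 
        by (rule open_Int[OF U(1)], rule open_Collect_neq) (rule continuous_intros)+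
      moreover have "?S \<noteq> {}"
      proof -
        obtain e where e: "0 < e" "ball z e \<subseteq> U" using U(1) \<open>z \<in> U\<close> open_contains_ball by blast
        \<comment> \<open>Moving from \<open>z\<close> by \<open>r *\<^sub>R \<delta> z\<close>
          covers half the radius, so the point stays in the ball, and its difference from
          \<open>z\<close> is parallel to \<open>\<delta> z\<close>.\<close>
        define r where "r = e / (2 * norm (\<delta> z))"
        have r: "0 < r" "r * norm (\<delta> z) < e" using e \<open>\<delta> z \<noteq> 0\<close> by (simp_all add: r_def)
        then have "z - r *\<^sub>R \<delta> z \<in> U" using e(2) by (auto simp: subset_eq dist_norm)
        moreover have "\<delta> z \<bullet> (z - (z - r *\<^sub>R \<delta> z)) \<noteq> 0" using r \<open>\<delta> z \<noteq> 0\<close> by simp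
        ultimately show ?thesis by blast
      qed
      ultimately obtain x where "x \<in> ?S" "x \<in> U \<longrightarrow> z \<in> U \<longrightarrow> \<delta> z \<bullet> (z - x) = 0"
        by (rule AE_lborel_open_ex[OF elim])
      then show False using \<open>z \<in> U\<close> by blast
    qed
  qed
qed

text \<open>An infimum of functions with constant \<open>L\<close> has constant \<open>L\<close>
  again. Extending off \<open>U\<close> removes the boundary from difference quotients; extending
  off an arbitrary set repairs functions known only almost everywhere.\<close>

lemma mcshane_extension:
  fixes N :: "real ^ 'n \<Rightarrow> real"
  assumes N: "is_norm N" and L: "0 \<le> L" and A: "A \<noteq> {}"
    and h: "\<And>x y. x \<in> A \<Longrightarrow> y \<in> A \<Longrightarrow> \<bar>h x - h y\<bar> \<le> L * N (x - y)"
  obtains f where "\<And>x. x \<in> A \<Longrightarrow> f x = h x" "\<And>x y. \<bar>f x - f y\<bar> \<le> L * N (x - y)"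
proof
  define f where "f x = (INF a\<in>A. h a + L * N (x - a))" for x
  have tri: "L * N (x - z) \<le> L * N (x - y) + L * N (y - z)" for x y z
    using mult_left_mono[OF is_norm_triangle_diff[OF N, of x z y] L] by (simp add: distrib_left)
  have lower: "h b - L * N (b - x) \<le> h a + L * N (x - a)" if "a \<in> A" "b \<in> A" for a b x
    using h[OF that] tri[of b a x] is_norm_commute[OF N, of a b] by (simp add: abs_le_iff)
  obtain b where b: "b \<in> A" using A by blast
  have bdd: "bdd_below ((\<lambda>a. h a + L * N (x - a)) ` A)" for x
    by (rule bdd_belowI2[where m="h b - L * N (b - x)"]) (use lower b in blast)
  show "f x = h x" if x: "x \<in> A" for x
  proof (rule antisym)
    show "f x \<le> h x" unfolding f_def
      using cINF_lower[OF bdd x, of x] by (simp add: is_norm_zero[OF N])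
    show "h x \<le> f x" unfolding f_def
      by (rule cINF_greatest[OF A]) (use lower[OF _ x, of _ x] in \<open>simp add: is_norm_zero[OF N]\<close>)
  qed
  have le: "f x - L * N (x - y) \<le> f y" for x y
    unfolding f_def[of y]
  proof (rule cINF_greatest[OF A])
    fix a assume "a \<in> A"
    then have "f x \<le> h a + L * N (x - a)" unfolding f_def by (rule cINF_lower[OF bdd])
    then show "f x - L * N (x - y) \<le> h a + L * N (y - a)" using tri[of x a y] by simp
  qed
  show "\<bar>f x - f y\<bar> \<le> L * N (x - y)" for x y
    using le[of x y] le[of y x] is_norm_commute[OF N, of x y] by (simp add: abs_le_iff)
qed

text \<open>Two points of \<open>A\<close> need not satisfy the inequality with each other, but both
  satisfy it with some common \<open>y\<close> arbitrarily close to one of them. So \<open>h\<close>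
  is Lipschitz on \<open>A\<close>, with the same constant, and extends.\<close>

lemma AE_lipschitz_imp_lipschitz:
  fixes N :: "real ^ 'n \<Rightarrow> real"
  assumes N: "is_norm N" and L: "0 \<le> L" and U: "open U" "U \<noteq> {}"
    and h: "AE x in lborel. x \<in> U \<longrightarrow> (AE y in lborel. y \<in> U \<longrightarrow> \<bar>h y - h x\<bar> \<le> L * N (y - x))"
  obtains f where "AE x in lborel. x \<in> U \<longrightarrow> h x = f x" "\<And>x y. \<bar>f x - f y\<bar> \<le> L * N (x - y)"
proof -
  define A where "A = {x \<in> U. AE y in lborel. y \<in> U \<longrightarrow> \<bar>h y - h x\<bar> \<le> L * N (y - x)}"
  have A: "A \<noteq> {}" by (rule AE_lborel_open_ex[OF h U]) (auto simp: A_def)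
  have "\<bar>h a - h b\<bar> \<le> L * N (a - b)" if a: "a \<in> A" and b: "b \<in> A" for a b
  proof (rule field_le_epsilon)
    fix e :: real assume e: "0 < e"
    \<comment> \<open>The detour through \<open>y\<close> costs twice \<open>L * N (y - a)\<close>;
      the summand 1 covers \<open>L = 0\<close>.\<close>
    let ?S = "U \<inter> {y. N (y - a) < e / (2 * L + 1)}"
    have "open ?S"
      by (intro open_Int U open_Collect_less continuous_intros
          continuous_on_compose2[OF continuous_on_is_norm[OF N, of UNIV]]) auto
    moreover have "?S \<noteq> {}" using a e L by (auto simp: A_def is_norm_zero[OF N] intro!: exI[of _ a])
    moreover have "AE y in lborel. y \<in> U \<longrightarrow> \<bar>h y - h a\<bar> \<le> L * N (y - a) \<and> \<bar>h y - h b\<bar> \<le> L * N (y - b)"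
      using a b unfolding A_def by (auto elim: eventually_elim2)
    ultimately obtain y where y: "y \<in> ?S" "y \<in> U \<longrightarrow> \<bar>h y - h a\<bar> \<le> L * N (y - a) \<and> \<bar>h y - h b\<bar> \<le> L * N (y - b)"
      using AE_lborel_open_ex by blast
    have "L * N (y - b) \<le> L * N (y - a) + L * N (a - b)"
      using mult_left_mono[OF is_norm_triangle_diff[OF N, of y b a] L] by (simp add: distrib_left)
    moreover have "2 * (L * N (y - a)) \<le> e"
    proof -
      have "(2 * L + 1) * N (y - a) \<le> e" using y(1) L by (simp add: field_simps)
      then show ?thesis using is_norm_nonneg[OF N, of "y - a"] by (simp add: algebra_simps)
    qed
    ultimately show "\<bar>h a - h b\<bar> \<le> L * N (a - b) + e" using y by (auto simp: abs_le_iff)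
  qed
  then obtain f where f: "\<And>x. x \<in> A \<Longrightarrow> f x = h x" "\<And>x y. \<bar>f x - f y\<bar> \<le> L * N (x - y)"
    using mcshane_extension[OF N L A] by blast
  show ?thesis
  proof
    show "AE x in lborel. x \<in> U \<longrightarrow> h x = f x"
      using h by eventually_elim (auto simp: A_def f(1))
  qed (rule f(2))
qed

section \<open>The isometry\<close>

text \<open>The gradient is characterised by segment integrals instead of derivatives. The base
  point ranges over all of \<open>U\<close>, so 0 is included.\<close>

definition is_gradient :: "(real ^ 'n) set \<Rightarrow> (real ^ 'n \<Rightarrow> real) \<Rightarrow> (real ^ 'n \<Rightarrow> real ^ 'n) \<Rightarrow> bool" where
  "is_gradient U f \<gamma> \<longleftrightarrow> \<gamma> \<in> borel_measurable borel \<and> (\<exists>B. \<forall>x. norm (\<gamma> x) \<le> B) \<and>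
     (\<forall>x\<in>U. AE y in lborel. y \<in> U \<longrightarrow> f y - f x = line_integral \<gamma> x y)"

text \<open>A relation between representatives, so that classes enter only at the very end.
  \<open>f\<close> is tied to \<open>T_op 0 g\<close> almost everywhere only; its continuity fixes
  the remaining values.\<close>

definition is_potential :: "(real ^ 'n \<Rightarrow> real) \<Rightarrow> (real ^ 'n) set \<Rightarrow> (real ^ 'n \<Rightarrow> 'n dual) \<Rightarrow> (real ^ 'n \<Rightarrow> real) \<Rightarrow> bool" where
  "is_potential N U g f \<longleftrightarrow> g \<in> Linf_fun N U \<and> f \<in> Lip0_vectors N U \<and> lipschitz_compatible U g \<and>
     (AE y in lebesgue_on U. T_op 0 g y = f y)"

lemma line_integral_add:
  assumes "\<gamma> \<in> borel_measurable borel" "\<And>x. norm (\<gamma> x) \<le> B"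
    and "\<gamma>' \<in> borel_measurable borel" "\<And>x. norm (\<gamma>' x) \<le> B'"
  shows "line_integral (\<lambda>x. \<gamma> x + \<gamma>' x) x y = line_integral \<gamma> x y + line_integral \<gamma>' x y"
  unfolding line_integral_def inner_add_left
  by (intro set_integral_add set_integrable_line[OF assms(1,2)] set_integrable_line[OF assms(3,4)])

lemma line_integral_scaleR: "line_integral (\<lambda>x. c *\<^sub>R \<gamma> x) x y = c * line_integral \<gamma> x y"
  by (simp add: line_integral_def)

lemma line_integral_diff:
  assumes "\<gamma> \<in> borel_measurable borel" "\<And>x. norm (\<gamma> x) \<le> B"
    and "\<gamma>' \<in> borel_measurable borel" "\<And>x. norm (\<gamma>' x) \<le> B'"
  shows "line_integral (\<lambda>x. \<gamma> x - \<gamma>' x) x y = line_integral \<gamma> x y - line_integral \<gamma>' x y"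
  unfolding line_integral_def inner_diff_left
  by (intro set_integral_diff set_integrable_line[OF assms(1,2)] set_integrable_line[OF assms(3,4)])

lemma line_integral_bound:
  assumes "\<And>x. \<bar>\<gamma> x \<bullet> (y - x0)\<bar> \<le> M" "\<gamma> \<in> borel_measurable borel" "\<And>x. norm (\<gamma> x) \<le> B"
  shows "\<bar>line_integral \<gamma> x0 y\<bar> \<le> M"
proof -
  let ?k = "\<lambda>t. \<gamma> (x0 + t *\<^sub>R (y - x0)) \<bullet> (y - x0)"
  have int: "set_integrable lborel {0..1} ?k" by (rule set_integrable_line[OF assms(2,3)])
  have "\<bar>line_integral \<gamma> x0 y\<bar> \<le> (LINT t:{0..1}|lborel. \<bar>?k t\<bar>)"
    using integral_norm_bound[of lborel "\<lambda>t. indicator {0..1} t *\<^sub>R ?k t"]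
    by (simp add: line_integral_def set_lebesgue_integral_def abs_mult)
  also have "\<dots> \<le> (LINT t:{0..1::real}|lborel. M)"
    by (rule set_integral_mono[OF set_integrable_abs[OF int]]) (use assms(1) in \<open>simp_all add: set_integrable_def\<close>)
  also have "\<dots> = M" by (simp add: set_lebesgue_integral_def)
  finally show ?thesis .
qed

context
  fixes N :: "real ^ 'n \<Rightarrow> real" and U :: "(real ^ 'n) set"
  assumes N: "is_norm N" and U: "open U" "convex U" "0 \<in> U"
begin

lemma domain_borel: "U \<in> sets borel"
  using U(1) by simp

lemma near_point:
  assumes ae: "AE y in lborel. y \<in> U \<longrightarrow> P y" and x: "x \<in> U" and e: "0 < e"
  obtains y where "y \<in> U" "N (y - x) < e" "P y"
proof -
  let ?S = "U \<inter> {y. N (y - x) < e}"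
  have "open ?S"
    by (intro open_Int U(1) open_Collect_less continuous_intros
        continuous_on_compose2[OF continuous_on_is_norm[OF N, of UNIV]]) auto
  moreover have "?S \<noteq> {}" using x e by (auto simp: is_norm_zero[OF N] intro!: exI[of _ x])
  ultimately show ?thesis using AE_lborel_open_ex[OF ae] that by blast
qed

lemma Linf_fun_bound:
  assumes "g \<in> Linf_fun N U"
  obtains C where "0 \<le> C" "AE x in lebesgue_on U. dual_norm N (g x) \<le> C"
proof -
  obtain C where "AE x in lebesgue_on U. dual_norm N (g x) \<le> C"
    using assms by (auto simp: Linf_fun_def)
  then have "AE x in lebesgue_on U. dual_norm N (g x) \<le> max C 0" by eventually_elim simp
  then show ?thesis using that[of "max C 0"] by simp
qed

lemma Linf_fun_bounded_representative:
  assumes C: "0 \<le> C" and g: "g \<in> Linf_fun N U" "AE x in lebesgue_on U. dual_norm N (g x) \<le> C"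
  obtains \<gamma> B where "\<gamma> \<in> borel_measurable borel" "\<And>x v. \<bar>\<gamma> x \<bullet> v\<bar> \<le> C * N v" "\<And>x. norm (\<gamma> x) \<le> B"
    "AE x in lebesgue_on U. g x = blinfun_inner_right (\<gamma> x)"
proof -
  obtain K where K: "0 \<le> K" "\<And>x. N x \<le> K * norm x" by (rule is_norm_upper[OF N]) blast
  obtain \<gamma> where \<gamma>: "\<gamma> \<in> borel_measurable borel" "\<And>x v. \<bar>\<gamma> x \<bullet> v\<bar> \<le> C * N v"
    "AE x in lebesgue_on U. g x = blinfun_inner_right (\<gamma> x)"
    by (rule Linf_fun_representative[OF N domain_borel C g]) blast
  show ?thesis
    by (rule that[OF \<gamma>(1,2) _ \<gamma>(3)]) (rule norm_le_if_dual_bound[OF N C \<gamma>(2) K(2)])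
qed

lemma Lip0_vectorsE:
  assumes "f \<in> Lip0_vectors N U"
  obtains L where "0 \<le> L" "\<And>x y. x \<in> U \<Longrightarrow> y \<in> U \<Longrightarrow> \<bar>f x - f y\<bar> \<le> L * N (x - y)"
proof -
  obtain L where L: "\<And>x y. x \<in> U \<Longrightarrow> y \<in> U \<Longrightarrow> \<bar>f x - f y\<bar> \<le> L * N (x - y)"
    using assms by (auto simp: Lip0_vectors_def)
  have "\<bar>f x - f y\<bar> \<le> max L 0 * N (x - y)" if "x \<in> U" "y \<in> U" for x y
    using L[OF that] mult_right_mono[of L "max L 0" "N (x - y)"] is_norm_nonneg[OF N] by fastforce
  then show ?thesis using that[of "max L 0"] by simp
qed

text \<open>Differentiability comes from a Euclidean constant, but the bound on
  \<open>\<gamma>\<close> must have the original \<open>L\<close> and \<open>N\<close>. It is read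
  off the quotients of an extension that keeps this constant.\<close>

lemma gradient_exists:
  assumes L: "0 \<le> L" and f: "\<And>x y. x \<in> U \<Longrightarrow> y \<in> U \<Longrightarrow> \<bar>f x - f y\<bar> \<le> L * N (x - y)"
  obtains \<gamma> where "is_gradient U f \<gamma>" "\<And>x v. \<bar>\<gamma> x \<bullet> v\<bar> \<le> L * N v"
proof -
  obtain K where K: "0 \<le> K" "\<And>x. N x \<le> K * norm x" by (rule is_norm_upper[OF N]) blast
  obtain F where F: "\<And>x. x \<in> U \<Longrightarrow> F x = f x" "\<And>x y. \<bar>F x - F y\<bar> \<le> L * N (x - y)"
    using mcshane_extension[OF N L _ f] U(3) by blast
  obtain L' where lip: "L'-lipschitz_on UNIV F"
    by (rule lipschitz_on_if_is_norm_lipschitz[OF N L F(2)]) blast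
  obtain \<gamma>0 where \<gamma>0_meas[measurable]: "\<gamma>0 \<in> borel_measurable borel"
    and \<gamma>0: "AE x in lborel. \<forall>v. (\<lambda>n. diff_quot F v n x) \<longlonglongrightarrow> \<gamma>0 x \<bullet> v"
    by (rule rademacher[OF lip]) blast
  define D where "D = {w. \<forall>v. \<bar>w \<bullet> v\<bar> \<le> L * N v}"
  have [measurable]: "D \<in> sets borel" unfolding D_def by (rule borel_inner_bound_set)
  define \<gamma> where "\<gamma> x = (if \<gamma>0 x \<in> D then \<gamma>0 x else 0)" for x
  have \<gamma>_meas: "\<gamma> \<in> borel_measurable borel" unfolding \<gamma>_def by measurable
  have \<gamma>_bound: "\<bar>\<gamma> x \<bullet> v\<bar> \<le> L * N v" for x v
    using L is_norm_nonneg[OF N, of v] by (auto simp: \<gamma>_def D_def)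
  have dq_bound: "\<bar>diff_quot F v n x\<bar> \<le> L * N v" for v n x
  proof -
    have "real (Suc n) * \<bar>F (x + v /\<^sub>R real (Suc n)) - F x\<bar> \<le> real (Suc n) * (L * N (v /\<^sub>R real (Suc n)))"
      using F(2)[of "x + v /\<^sub>R real (Suc n)" x] by (intro mult_left_mono) simp_all
    also have "\<dots> = L * N v" by (simp add: is_norm_scaleR[OF N] del: of_nat_Suc)
    finally show ?thesis by (simp add: diff_quot_def abs_mult del: of_nat_Suc)
  qed
  have \<gamma>: "AE x in lborel. \<forall>v. (\<lambda>n. diff_quot F v n x) \<longlonglongrightarrow> \<gamma> x \<bullet> v"
    using \<gamma>0
  proof eventually_elim
    case (elim x)
    have "\<bar>\<gamma>0 x \<bullet> v\<bar> \<le> L * N v" for v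
      by (rule LIMSEQ_le_const2[OF tendsto_rabs[OF elim[rule_format]]]) (use dq_bound in blast)
    then have "\<gamma> x = \<gamma>0 x" by (simp add: \<gamma>_def D_def)
    then show ?case using elim by simp
  qed
  have "AE y in lborel. y \<in> U \<longrightarrow> f y - f x = line_integral \<gamma> x y" if "x \<in> U" for x
    using lipschitz_line_integral[OF lip \<gamma>_meas \<gamma>, of x]
    by eventually_elim (use F(1) that in \<open>auto simp: line_integral_def\<close>)
  then have "is_gradient U f \<gamma>"
    unfolding is_gradient_def
    using \<gamma>_meas norm_le_if_dual_bound[OF N L \<gamma>_bound K(2)] by blast
  with \<gamma>_bound show ?thesis by (intro that)
qed

lemma Linf_funI:
  assumes "\<gamma> \<in> borel_measurable borel" "\<And>x v. \<bar>\<gamma> x \<bullet> v\<bar> \<le> L * N v" "0 \<le> L"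
  shows "(\<lambda>x. blinfun_inner_right (\<gamma> x)) \<in> Linf_fun N U"
proof -
  have "(\<lambda>x. blinfun_inner_right (\<gamma> x)) \<in> borel_measurable borel"
    using assms(1) by measurable
  then have "(\<lambda>x. blinfun_inner_right (\<gamma> x)) \<in> borel_measurable (lebesgue_on U)"
    by (intro measurable_restrict_space1 measurable_completion) simp
  moreover have "AE x in lebesgue_on U. dual_norm N (blinfun_inner_right (\<gamma> x)) \<le> L"
    using assms(2,3) by (intro AE_I2) (simp add: dual_norm_le_iff[OF N])
  ultimately show ?thesis by (auto simp: Linf_fun_def)
qed

text \<open>Both sides of the compatibility equation become \<open>f y - f x\<close>: the left one
  since \<open>f 0 = 0\<close>, the right one as a segment integral of the gradient.\<close>

lemma is_potential_if_gradient:
  assumes f: "f \<in> Lip0_vectors N U" and grad: "is_gradient U f \<gamma>"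
    and g: "g \<in> Linf_fun N U" and ae: "AE x in lebesgue_on U. g x = blinfun_inner_right (\<gamma> x)"
  shows "is_potential N U g f"
proof -
  obtain B where \<gamma>: "\<gamma> \<in> borel_measurable borel" "\<And>x. norm (\<gamma> x) \<le> B"
    and line: "\<And>x. x \<in> U \<Longrightarrow> AE y in lborel. y \<in> U \<longrightarrow> f y - f x = line_integral \<gamma> x y"
    using grad by (auto simp: is_gradient_def)
  have [measurable]: "U \<in> sets borel" by (rule domain_borel)
  have f0: "f 0 = 0" using f by (simp add: Lip0_vectors_def)
  obtain L where L: "0 \<le> L" "\<And>x y. x \<in> U \<Longrightarrow> y \<in> U \<Longrightarrow> \<bar>f x - f y\<bar> \<le> L * N (x - y)"
    by (rule Lip0_vectorsE[OF f]) blast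
  \<comment> \<open>A globally continuous substitute for \<open>f\<close>, which makes the set of
    good pairs measurable in the product.\<close>
  obtain F where F: "\<And>x. x \<in> U \<Longrightarrow> F x = f x" "\<And>x y. \<bar>F x - F y\<bar> \<le> L * N (x - y)"
    using mcshane_extension[OF N L(1) _ L(2)] U(3) by blast
  obtain L' where "L'-lipschitz_on UNIV F"
    by (rule lipschitz_on_if_is_norm_lipschitz[OF N L(1) F(2)]) blast
  then have [measurable]: "F \<in> borel_measurable borel"
    by (intro borel_measurable_continuous_onI lipschitz_on_continuous_on)
  note T = T_op_AE[OF domain_borel U(2) \<gamma> ae]
  have T0: "AE y in lborel. y \<in> U \<longrightarrow> T_op 0 g y = f y"
    using T(1)[OF U(3)] line[OF U(3)] by eventually_elim (simp add: f0)
  have pair: "AE w in lborel \<Otimes>\<^sub>M lborel. fst w \<in> U \<longrightarrow> snd w \<in> U \<longrightarrow>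
      F (snd w) - F (fst w) = line_integral \<gamma> (fst w) (snd w)"
  proof (rule lborel_pair.AE_pair_measure)
    have [measurable]: "(\<lambda>w. line_integral \<gamma> (fst w) (snd w)) \<in> borel_measurable (lborel \<Otimes>\<^sub>M lborel)"
      by (rule borel_measurable_line_integral[OF \<gamma>(1)])
    show "{w \<in> space (lborel \<Otimes>\<^sub>M lborel). fst w \<in> U \<longrightarrow> snd w \<in> U \<longrightarrow>
        F (snd w) - F (fst w) = line_integral \<gamma> (fst w) (snd w)} \<in> sets (lborel \<Otimes>\<^sub>M lborel)"
      by measurable
    show "AE x in lborel. AE y in lborel. fst (x, y) \<in> U \<longrightarrow> snd (x, y) \<in> U \<longrightarrow>
        F (snd (x, y)) - F (fst (x, y)) = line_integral \<gamma> (fst (x, y)) (snd (x, y))"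
    proof (rule AE_I2)
      fix x
      show "AE y in lborel. fst (x, y) \<in> U \<longrightarrow> snd (x, y) \<in> U \<longrightarrow>
          F (snd (x, y)) - F (fst (x, y)) = line_integral \<gamma> (fst (x, y)) (snd (x, y))"
      proof (cases "x \<in> U")
        case True
        show ?thesis using line[OF True] by eventually_elim (simp add: F(1))
      qed simp
    qed
  qed
  have "AE w in lebesgue_on U \<Otimes>\<^sub>M lebesgue_on U. T_op 0 g (snd w) - T_op 0 g (fst w) = T_op (fst w) g (snd w)"
  proof (rule AE_pair_lebesgue_onI[OF domain_borel])
    show "AE w in lborel \<Otimes>\<^sub>M lborel. fst w \<in> U \<longrightarrow> snd w \<in> U \<longrightarrow>
        T_op 0 g (snd w) - T_op 0 g (fst w) = T_op (fst w) g (snd w)"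
      using pair T(2) AE_pair_fst_snd[OF T0] by eventually_elim (use F(1) in auto)
  qed
  then have "lipschitz_compatible U g" by (simp add: lipschitz_compatible_def case_prod_unfold)
  then show ?thesis using f g T0 by (simp add: is_potential_def AE_lebesgue_on_iff[OF domain_borel])
qed

text \<open>Compatibility holds only for almost all pairs, so the identity that
  \<open>is_gradient\<close> has at every base point is obtained here at almost every one.\<close>

lemma potential_line_integral:
  assumes "is_potential N U g f" "\<gamma> \<in> borel_measurable borel" "\<And>x. norm (\<gamma> x) \<le> B"
    "AE x in lebesgue_on U. g x = blinfun_inner_right (\<gamma> x)"
  shows "AE x in lborel. x \<in> U \<longrightarrow> (AE y in lborel. y \<in> U \<longrightarrow> f y - f x = line_integral \<gamma> x y)"
proof -
  have T0: "AE y in lborel. y \<in> U \<longrightarrow> T_op 0 g y = f y"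
    and "lipschitz_compatible U g"
    using assms(1) by (simp_all add: is_potential_def AE_lebesgue_on_iff[OF domain_borel])
  then have "AE w in lebesgue_on U \<Otimes>\<^sub>M lebesgue_on U. T_op 0 g (snd w) - T_op 0 g (fst w) = T_op (fst w) g (snd w)"
    by (simp add: lipschitz_compatible_def case_prod_unfold)
  from AE_pair_lebesgue_onD[OF domain_borel this] T0
  show ?thesis
  proof eventually_elim
    case (elim x)
    show ?case
    proof
      assume x: "x \<in> U"
      then have "AE y in lborel. y \<in> U \<longrightarrow> T_op 0 g y - T_op 0 g x = T_op x g y" using elim(1) by simp
      then show "AE y in lborel. y \<in> U \<longrightarrow> f y - f x = line_integral \<gamma> x y"
        using T0 T_op_AE(1)[OF domain_borel U(2) assms(2,3,4) x]
        by eventually_elim (use elim(2) x in auto)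
    qed
  qed
qed

text \<open>A Borel representative of \<open>g\<close> and \<open>\<gamma>\<close> have the same
  integrals, both increments of \<open>f\<close>, along almost all segments from almost every base
  point. Their difference is a bounded field to which \<open>line_integral_zero_imp_zero\<close>
  applies.\<close>

lemma gradient_AE_eq:
  assumes pot: "is_potential N U g f" and grad: "is_gradient U f \<gamma>"
  shows "AE x in lebesgue_on U. g x = blinfun_inner_right (\<gamma> x)"
proof -
  obtain B where \<gamma>: "\<gamma> \<in> borel_measurable borel" "\<And>x. norm (\<gamma> x) \<le> B"
    and line: "\<And>x. x \<in> U \<Longrightarrow> AE y in lborel. y \<in> U \<longrightarrow> f y - f x = line_integral \<gamma> x y"
    using grad by (auto simp: is_gradient_def)
  have g: "g \<in> Linf_fun N U" using pot by (simp add: is_potential_def)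
  obtain C where C: "0 \<le> C" "AE x in lebesgue_on U. dual_norm N (g x) \<le> C"
    by (rule Linf_fun_bound[OF g]) blast
  obtain \<gamma>' B' where \<gamma>': "\<gamma>' \<in> borel_measurable borel" "\<And>x. norm (\<gamma>' x) \<le> B'"
    and ae: "AE x in lebesgue_on U. g x = blinfun_inner_right (\<gamma>' x)"
    by (rule Linf_fun_bounded_representative[OF C(1) g C(2)]) blast
  have "AE z in lborel. z \<in> U \<longrightarrow> \<gamma> z - \<gamma>' z = 0"
  proof (rule line_integral_zero_imp_zero[OF U(1,2)])
    show "(\<lambda>z. \<gamma> z - \<gamma>' z) \<in> borel_measurable borel" using \<gamma>(1) \<gamma>'(1) by measurable
    show "norm (\<gamma> z - \<gamma>' z) \<le> B + B'" for z
      using norm_triangle_ineq4[of "\<gamma> z" "\<gamma>' z"] \<gamma>(2)[of z] \<gamma>'(2)[of z] by linarith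
    show "AE x in lborel. x \<in> U \<longrightarrow> (AE y in lborel. y \<in> U \<longrightarrow> line_integral (\<lambda>z. \<gamma> z - \<gamma>' z) x y = 0)"
      using potential_line_integral[OF pot \<gamma>' ae]
    proof eventually_elim
      case (elim x)
      show ?case
      proof
        assume x: "x \<in> U"
        then have "AE y in lborel. y \<in> U \<longrightarrow> f y - f x = line_integral \<gamma>' x y" using elim by simp
        then show "AE y in lborel. y \<in> U \<longrightarrow> line_integral (\<lambda>z. \<gamma> z - \<gamma>' z) x y = 0"
          using line[OF x] by eventually_elim (simp add: line_integral_diff[OF \<gamma> \<gamma>'])
      qed
    qed
  qed
  then show ?thesis
    using ae unfolding AE_lebesgue_on_iff[OF domain_borel] by eventually_elim simp
qed

text \<open>Both functions agree almost everywhere with \<open>T_op 0 g\<close>. Near each point of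
  \<open>U\<close> there are such points of agreement, and Lipschitz continuity does the
  rest.\<close>

lemma potential_unique:
  assumes "is_potential N U g f" "is_potential N U g f'"
  shows "f = f'"
proof (rule extensionalityI)
  have f: "f \<in> Lip0_vectors N U" "f' \<in> Lip0_vectors N U"
    using assms by (simp_all add: is_potential_def)
  then show "f \<in> extensional U" "f' \<in> extensional U" by (simp_all add: Lip0_vectors_def)
  fix x assume x: "x \<in> U"
  obtain L where L: "0 \<le> L" "\<And>x y. x \<in> U \<Longrightarrow> y \<in> U \<Longrightarrow> \<bar>f x - f y\<bar> \<le> L * N (x - y)"
    by (rule Lip0_vectorsE[OF f(1)]) blast
  obtain L' where L': "0 \<le> L'" "\<And>x y. x \<in> U \<Longrightarrow> y \<in> U \<Longrightarrow> \<bar>f' x - f' y\<bar> \<le> L' * N (x - y)"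
    by (rule Lip0_vectorsE[OF f(2)]) blast
  have ae: "AE y in lborel. y \<in> U \<longrightarrow> f y = f' y"
    using assms unfolding is_potential_def AE_lebesgue_on_iff[OF domain_borel]
    by (auto elim: eventually_elim2)
  have "\<bar>f x - f' x\<bar> \<le> 0 + e" if e: "0 < e" for e
  proof -
    have "0 < e / (L + L' + 1)" using e L(1) L'(1) by simp
    then obtain y where y: "y \<in> U" "N (y - x) < e / (L + L' + 1)" "f y = f' y"
      by (rule near_point[OF ae x])
    have "(L + L' + 1) * N (y - x) \<le> e" using y(2) L(1) L'(1) by (simp add: field_simps)
    then show ?thesis
      using L(2)[OF y(1) x] L'(2)[OF y(1) x] y(3) is_norm_nonneg[OF N, of "y - x"]
      by (simp add: abs_le_iff algebra_simps)
  qed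
  then have "\<bar>f x - f' x\<bar> \<le> 0" by (rule field_le_epsilon)
  then show "f x = f' x" by simp
qed

text \<open>The Lipschitz inequality for \<open>T_op 0 g\<close> is known only almost everywhere,
  but already with the bound \<open>C\<close> of \<open>g\<close>; keeping \<open>C\<close> gives
  one half of the equality of norms.\<close>

lemma potential_exists:
  assumes C: "0 \<le> C" and g: "g \<in> Linf_fun N U" "AE x in lebesgue_on U. dual_norm N (g x) \<le> C"
    and compat: "lipschitz_compatible U g"
  obtains f where "is_potential N U g f" "\<And>x y. x \<in> U \<Longrightarrow> y \<in> U \<Longrightarrow> \<bar>f x - f y\<bar> \<le> C * N (x - y)"
proof -
  obtain \<gamma> B where \<gamma>: "\<gamma> \<in> borel_measurable borel" "\<And>x v. \<bar>\<gamma> x \<bullet> v\<bar> \<le> C * N v" "\<And>x. norm (\<gamma> x) \<le> B"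
    and ae: "AE x in lebesgue_on U. g x = blinfun_inner_right (\<gamma> x)"
    by (rule Linf_fun_bounded_representative[OF C g]) blast
  note T = T_op_AE[OF domain_borel U(2) \<gamma>(1,3) ae]
  have bound: "\<bar>line_integral \<gamma> x y\<bar> \<le> C * N (y - x)" for x y
    by (rule line_integral_bound[OF \<gamma>(2) \<gamma>(1,3)])
  have "AE w in lebesgue_on U \<Otimes>\<^sub>M lebesgue_on U. T_op 0 g (snd w) - T_op 0 g (fst w) = T_op (fst w) g (snd w)"
    using compat by (simp add: lipschitz_compatible_def case_prod_unfold)
  from AE_pair_lebesgue_onD[OF domain_borel this]
  have "AE x in lborel. x \<in> U \<longrightarrow> (AE y in lborel. y \<in> U \<longrightarrow> \<bar>T_op 0 g y - T_op 0 g x\<bar> \<le> C * N (y - x))"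
  proof eventually_elim
    case (elim x)
    show ?case
    proof
      assume x: "x \<in> U"
      then have "AE y in lborel. y \<in> U \<longrightarrow> T_op 0 g y - T_op 0 g x = T_op x g y" using elim by simp
      then show "AE y in lborel. y \<in> U \<longrightarrow> \<bar>T_op 0 g y - T_op 0 g x\<bar> \<le> C * N (y - x)"
        using T(1)[OF x] by eventually_elim (use bound in auto)
    qed
  qed
  then obtain F where F: "AE x in lborel. x \<in> U \<longrightarrow> T_op 0 g x = F x" "\<And>x y. \<bar>F x - F y\<bar> \<le> C * N (x - y)"
    using AE_lipschitz_imp_lipschitz[OF N C U(1), of "T_op 0 g"] U(3) by blast
  \<comment> \<open>Equality almost everywhere leaves the value of \<open>F\<close> at 0 open. It is
    forced to be 0 because segment integrals from 0 to nearby points are small.\<close>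
  have F_small: "AE y in lborel. y \<in> U \<longrightarrow> \<bar>F y\<bar> \<le> C * N (y - 0)"
    using F(1) T(1)[OF U(3)] by eventually_elim (use bound[of 0] in metis)
  have "\<bar>F 0\<bar> \<le> 0 + e" if e: "0 < e" for e
  proof -
    have "0 < e / (2 * C + 1)" using e C by simp
    then obtain y where y: "y \<in> U" "N (y - 0) < e / (2 * C + 1)" "\<bar>F y\<bar> \<le> C * N (y - 0)"
      by (rule near_point[OF F_small U(3)])
    have "(2 * C + 1) * N (y - 0) \<le> e" using y(2) C by (simp add: field_simps)
    then show ?thesis
      using y(3) F(2)[of y 0] is_norm_nonneg[OF N, of "y - 0"] by (simp add: abs_le_iff algebra_simps)
  qed
  then have "\<bar>F 0\<bar> \<le> 0" by (rule field_le_epsilon)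
  then have "restrict F U \<in> Lip0_vectors N U"
    using U(3) F(2) by (auto simp: Lip0_vectors_def)
  moreover have "AE y in lebesgue_on U. T_op 0 g y = restrict F U y"
    using F(1) unfolding AE_lebesgue_on_iff[OF domain_borel] by eventually_elim simp
  ultimately have "is_potential N U g (restrict F U)" using g(1) compat by (simp add: is_potential_def)
  then show ?thesis by (rule that) (use F(2) in simp)
qed

lemma Lip0_gradient:
  assumes "f \<in> Lip0_vectors N U"
  obtains \<gamma> where "is_gradient U f \<gamma>"
  by (rule Lip0_vectorsE[OF assms], rule gradient_exists) (use that in blast)+

lemma potential_surj:
  assumes f: "f \<in> Lip0_vectors N U"
  obtains g where "is_potential N U g f"
proof -
  obtain L where L: "0 \<le> L" "\<And>x y. x \<in> U \<Longrightarrow> y \<in> U \<Longrightarrow> \<bar>f x - f y\<bar> \<le> L * N (x - y)"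
    by (rule Lip0_vectorsE[OF f]) blast
  obtain \<gamma> where \<gamma>: "is_gradient U f \<gamma>" "\<And>x v. \<bar>\<gamma> x \<bullet> v\<bar> \<le> L * N v"
    by (rule gradient_exists[OF L]) blast+
  have "(\<lambda>x. blinfun_inner_right (\<gamma> x)) \<in> Linf_fun N U"
    using \<gamma>(1) by (intro Linf_funI[OF _ \<gamma>(2) L(1)]) (simp add: is_gradient_def)
  then have "is_potential N U (\<lambda>x. blinfun_inner_right (\<gamma> x)) f"
    by (rule is_potential_if_gradient[OF f \<gamma>(1)]) simp
  then show ?thesis by (rule that)
qed

text \<open>Compatibility of \<open>g'\<close> is not compared with that of \<open>g\<close>
  directly: both fields agree almost everywhere with a gradient of \<open>f\<close>.\<close>

lemma potential_AE_cong:
  assumes "is_potential N U g f" "g' \<in> Linf_fun N U" "AE x in lebesgue_on U. g x = g' x"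
  shows "is_potential N U g' f"
proof -
  have f: "f \<in> Lip0_vectors N U" using assms(1) by (simp add: is_potential_def)
  obtain \<gamma> where \<gamma>: "is_gradient U f \<gamma>" by (rule Lip0_gradient[OF f]) blast
  have "AE x in lebesgue_on U. g' x = blinfun_inner_right (\<gamma> x)"
    using gradient_AE_eq[OF assms(1) \<gamma>] assms(3) by eventually_elim simp
  then show ?thesis by (rule is_potential_if_gradient[OF f \<gamma> assms(2)])
qed

lemma potential_AE_unique:
  assumes "is_potential N U g f" "is_potential N U g' f"
  shows "AE x in lebesgue_on U. g x = g' x"
proof -
  obtain \<gamma> where \<gamma>: "is_gradient U f \<gamma>"
    using Lip0_gradient[of f] assms(1) by (auto simp: is_potential_def)
  show ?thesis
    using gradient_AE_eq[OF assms(1) \<gamma>] gradient_AE_eq[OF assms(2) \<gamma>] by eventually_elim simp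
qed

section \<open>Linear operations on fields, functions and potentials\<close>

lemma Linf_fun_add:
  assumes "g \<in> Linf_fun N U" "h \<in> Linf_fun N U"
  shows "(\<lambda>x. g x + h x) \<in> Linf_fun N U"
proof -
  have [measurable]: "g \<in> borel_measurable (lebesgue_on U)" "h \<in> borel_measurable (lebesgue_on U)"
    using assms by (simp_all add: Linf_fun_def)
  have "(\<lambda>x. blinfun_inner_right (riesz (g x) + riesz (h x))) \<in> borel_measurable (lebesgue_on U)"
    by measurable
  moreover have "blinfun_inner_right (riesz (g x) + riesz (h x)) = g x + h x" for x
    by (simp add: linear_add[OF bounded_linear.linear[OF bounded_linear_blinfun_inner_right]])
  ultimately have meas: "(\<lambda>x. g x + h x) \<in> borel_measurable (lebesgue_on U)" by simp
  obtain C where C: "0 \<le> C" "AE x in lebesgue_on U. dual_norm N (g x) \<le> C"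
    by (rule Linf_fun_bound[OF assms(1)]) blast
  obtain C' where C': "0 \<le> C'" "AE x in lebesgue_on U. dual_norm N (h x) \<le> C'"
    by (rule Linf_fun_bound[OF assms(2)]) blast
  have "AE x in lebesgue_on U. dual_norm N (g x + h x) \<le> C + C'"
    using C(2) C'(2)
  proof eventually_elim
    case (elim x)
    have "\<bar>blinfun_apply (g x + h x) v\<bar> \<le> (C + C') * N v" for v
    proof -
      have "\<bar>blinfun_apply (g x) v\<bar> \<le> C * N v" "\<bar>blinfun_apply (h x) v\<bar> \<le> C' * N v"
        using elim by (simp_all add: dual_norm_le_iff[OF N])
      then show ?thesis by (simp add: blinfun.add_left distrib_right)
    qed
    then show ?case using C(1) C'(1) by (simp add: dual_norm_le_iff[OF N])
  qed
  with meas show ?thesis by (auto simp: Linf_fun_def)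
qed

lemma Linf_fun_scaleR:
  assumes "g \<in> Linf_fun N U"
  shows "(\<lambda>x. c *\<^sub>R g x) \<in> Linf_fun N U"
proof -
  have [measurable]: "g \<in> borel_measurable (lebesgue_on U)" using assms by (simp add: Linf_fun_def)
  have "(\<lambda>x. blinfun_inner_right (c *\<^sub>R riesz (g x))) \<in> borel_measurable (lebesgue_on U)"
    by measurable
  moreover have "blinfun_inner_right (c *\<^sub>R riesz (g x)) = c *\<^sub>R g x" for x
    by (simp add: linear_scale[OF bounded_linear.linear[OF bounded_linear_blinfun_inner_right]])
  ultimately have meas: "(\<lambda>x. c *\<^sub>R g x) \<in> borel_measurable (lebesgue_on U)" by simp
  obtain C where C: "0 \<le> C" "AE x in lebesgue_on U. dual_norm N (g x) \<le> C"
    by (rule Linf_fun_bound[OF assms(1)]) blast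
  have "AE x in lebesgue_on U. dual_norm N (c *\<^sub>R g x) \<le> \<bar>c\<bar> * C"
    using C(2)
  proof eventually_elim
    case (elim x)
    have "\<bar>blinfun_apply (c *\<^sub>R g x) v\<bar> \<le> \<bar>c\<bar> * C * N v" for v
    proof -
      have "\<bar>blinfun_apply (g x) v\<bar> \<le> C * N v" using elim by (simp add: dual_norm_le_iff[OF N])
      then show ?thesis by (simp add: blinfun.scaleR_left abs_mult mult.assoc mult_left_mono)
    qed
    then show ?case using C(1) by (simp add: dual_norm_le_iff[OF N])
  qed
  with meas show ?thesis by (auto simp: Linf_fun_def)
qed

lemma Lip0_vectors_add:
  assumes "f \<in> Lip0_vectors N U" "h \<in> Lip0_vectors N U"
  shows "(\<lambda>x\<in>U. f x + h x) \<in> Lip0_vectors N U"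
proof -
  obtain L where L: "\<And>x y. x \<in> U \<Longrightarrow> y \<in> U \<Longrightarrow> \<bar>f x - f y\<bar> \<le> L * N (x - y)"
    by (rule Lip0_vectorsE[OF assms(1)]) blast
  obtain L' where L': "\<And>x y. x \<in> U \<Longrightarrow> y \<in> U \<Longrightarrow> \<bar>h x - h y\<bar> \<le> L' * N (x - y)"
    by (rule Lip0_vectorsE[OF assms(2)]) blast
  have "\<bar>(f x + h x) - (f y + h y)\<bar> \<le> (L + L') * N (x - y)" if "x \<in> U" "y \<in> U" for x y
    using L[OF that] L'[OF that] by (simp add: distrib_right abs_le_iff)
  then show ?thesis using assms U(3) by (auto simp: Lip0_vectors_def intro!: exI[of _ "L + L'"])
qed

lemma Lip0_vectors_scale:
  assumes "f \<in> Lip0_vectors N U"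
  shows "(\<lambda>x\<in>U. c * f x) \<in> Lip0_vectors N U"
proof -
  obtain L where L: "\<And>x y. x \<in> U \<Longrightarrow> y \<in> U \<Longrightarrow> \<bar>f x - f y\<bar> \<le> L * N (x - y)"
    by (rule Lip0_vectorsE[OF assms(1)]) blast
  have "\<bar>c * f x - c * f y\<bar> \<le> (\<bar>c\<bar> * L) * N (x - y)" if "x \<in> U" "y \<in> U" for x y
    using mult_left_mono[OF L[OF that] abs_ge_zero[of c]]
    by (simp add: right_diff_distrib[symmetric] abs_mult mult.assoc)
  then show ?thesis using assms U(3) by (auto simp: Lip0_vectors_def intro!: exI[of _ "\<bar>c\<bar> * L"])
qed

text \<open>The default value spoils additivity of \<open>T_op\<close> at points where an integral
  does not exist. Gradients are added instead, and compatibility of the sum is a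
  consequence.\<close>

lemma potential_add:
  assumes "is_potential N U g f" "is_potential N U h k"
  shows "is_potential N U (\<lambda>x. g x + h x) (\<lambda>x\<in>U. f x + k x)"
proof -
  have f: "f \<in> Lip0_vectors N U" "k \<in> Lip0_vectors N U" and g: "g \<in> Linf_fun N U" "h \<in> Linf_fun N U"
    using assms by (simp_all add: is_potential_def)
  obtain \<gamma> where \<gamma>: "is_gradient U f \<gamma>" by (rule Lip0_gradient[OF f(1)]) blast
  obtain \<eta> where \<eta>: "is_gradient U k \<eta>" by (rule Lip0_gradient[OF f(2)]) blast
  obtain B B' where B: "\<And>x. norm (\<gamma> x) \<le> B" "\<And>x. norm (\<eta> x) \<le> B'"
    and meas: "\<gamma> \<in> borel_measurable borel" "\<eta> \<in> borel_measurable borel"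
    using \<gamma> \<eta> by (auto simp: is_gradient_def)
  have "is_gradient U (\<lambda>x\<in>U. f x + k x) (\<lambda>x. \<gamma> x + \<eta> x)"
    unfolding is_gradient_def
  proof (intro conjI ballI exI allI)
    show "(\<lambda>x. \<gamma> x + \<eta> x) \<in> borel_measurable borel" using meas by measurable
    show "norm (\<gamma> x + \<eta> x) \<le> B + B'" for x
      by (rule norm_triangle_le) (intro add_mono B)
    fix x assume x: "x \<in> U"
    have "AE y in lborel. y \<in> U \<longrightarrow> f y - f x = line_integral \<gamma> x y"
      "AE y in lborel. y \<in> U \<longrightarrow> k y - k x = line_integral \<eta> x y"
      using \<gamma> \<eta> x by (simp_all add: is_gradient_def)
    then show "AE y in lborel. y \<in> U \<longrightarrow>
        (\<lambda>x\<in>U. f x + k x) y - (\<lambda>x\<in>U. f x + k x) x = line_integral (\<lambda>x. \<gamma> x + \<eta> x) x y"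
      by eventually_elim (use x line_integral_add[OF meas(1) B(1) meas(2) B(2)] in auto)
  qed
  moreover have "AE x in lebesgue_on U. g x + h x = blinfun_inner_right (\<gamma> x + \<eta> x)"
    using gradient_AE_eq[OF assms(1) \<gamma>] gradient_AE_eq[OF assms(2) \<eta>]
    by eventually_elim (simp add: linear_add[OF bounded_linear.linear[OF bounded_linear_blinfun_inner_right]])
  ultimately show ?thesis
    using Lip0_vectors_add[OF f] Linf_fun_add[OF g] by (intro is_potential_if_gradient)
qed

lemma potential_scale:
  assumes "is_potential N U g f"
  shows "is_potential N U (\<lambda>x. c *\<^sub>R g x) (\<lambda>x\<in>U. c * f x)"
proof -
  have f: "f \<in> Lip0_vectors N U" and g: "g \<in> Linf_fun N U"
    using assms by (simp_all add: is_potential_def)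
  obtain \<gamma> where \<gamma>: "is_gradient U f \<gamma>" by (rule Lip0_gradient[OF f]) blast
  obtain B where B: "\<And>x. norm (\<gamma> x) \<le> B" and meas: "\<gamma> \<in> borel_measurable borel"
    using \<gamma> by (auto simp: is_gradient_def)
  have "is_gradient U (\<lambda>x\<in>U. c * f x) (\<lambda>x. c *\<^sub>R \<gamma> x)"
    unfolding is_gradient_def
  proof (intro conjI ballI exI allI)
    show "(\<lambda>x. c *\<^sub>R \<gamma> x) \<in> borel_measurable borel" using meas by measurable
    show "norm (c *\<^sub>R \<gamma> x) \<le> \<bar>c\<bar> * B" for x using B[of x] by (simp add: mult_left_mono)
    fix x assume x: "x \<in> U"
    have "AE y in lborel. y \<in> U \<longrightarrow> f y - f x = line_integral \<gamma> x y"
      using \<gamma> x by (simp add: is_gradient_def)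
    then show "AE y in lborel. y \<in> U \<longrightarrow>
        (\<lambda>x\<in>U. c * f x) y - (\<lambda>x\<in>U. c * f x) x = line_integral (\<lambda>x. c *\<^sub>R \<gamma> x) x y"
      by eventually_elim (use x in \<open>auto simp: line_integral_scaleR right_diff_distrib[symmetric]\<close>)
  qed
  moreover have "AE x in lebesgue_on U. c *\<^sub>R g x = blinfun_inner_right (c *\<^sub>R \<gamma> x)"
    using gradient_AE_eq[OF assms \<gamma>]
    by eventually_elim (simp add: linear_scale[OF bounded_linear.linear[OF bounded_linear_blinfun_inner_right]])
  ultimately show ?thesis
    using Lip0_vectors_scale[OF f] Linf_fun_scaleR[OF g] by (intro is_potential_if_gradient)
qed

section \<open>Equality of the norms\<close>

lemma lip_norm_le_iff:
  assumes f: "f \<in> Lip0_vectors N U"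
  shows "lip_norm N U f \<le> C \<longleftrightarrow> 0 \<le> C \<and> (\<forall>x\<in>U. \<forall>y\<in>U. \<bar>f x - f y\<bar> \<le> C * N (x - y))"
proof -
  let ?P = "{(x, y). x \<in> U \<and> y \<in> U \<and> x \<noteq> y}"
  let ?q = "\<lambda>(x, y). \<bar>f x - f y\<bar> / N (x - y)"
  obtain L where L: "\<And>x y. x \<in> U \<Longrightarrow> y \<in> U \<Longrightarrow> \<bar>f x - f y\<bar> \<le> L * N (x - y)"
    by (rule Lip0_vectorsE[OF f]) blast
  have pos: "0 < N (x - y)" if "x \<noteq> y" for x y
    using that is_norm_nonneg[OF N, of "x - y"] is_norm_eq_0[OF N, of "x - y"] by simp
  have bdd: "bdd_above (?q ` ?P)"
    by (rule bdd_aboveI2[where M=L]) (use L pos in \<open>auto simp: divide_le_eq\<close>)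
  \<comment> \<open>A second point of \<open>U\<close> makes the index set of the supremum
    nonempty.\<close>
  obtain u where u: "u \<in> U" "u \<noteq> 0"
  proof -
    obtain e where "0 < e" "ball 0 e \<subseteq> U" using U(1,3) open_contains_ball by blast
    moreover obtain b :: "real ^ 'n" where "b \<in> Basis" using nonempty_Basis by blast
    ultimately show ?thesis by (intro that[of "(e / 2) *\<^sub>R b"]) (auto simp: subset_eq nonzero_Basis)
  qed
  have ne: "?P \<noteq> {}" using u U(3) by auto
  have "lip_norm N U f \<le> C \<longleftrightarrow> (\<forall>p\<in>?P. ?q p \<le> C)"
    unfolding lip_norm_def by (rule cSUP_le_iff[OF ne bdd])
  also have "\<dots> \<longleftrightarrow> 0 \<le> C \<and> (\<forall>x\<in>U. \<forall>y\<in>U. \<bar>f x - f y\<bar> \<le> C * N (x - y))"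
  proof (intro iffI conjI ballI)
    assume *: "\<forall>p\<in>?P. ?q p \<le> C"
    have "0 \<le> \<bar>f u - f 0\<bar> / N (u - 0)" using is_norm_nonneg[OF N] by simp
    also have "\<dots> \<le> C" using *[rule_format, of "(u, 0)"] u U(3) by simp
    finally show "0 \<le> C" .
    show "\<bar>f x - f y\<bar> \<le> C * N (x - y)" if "x \<in> U" "y \<in> U" for x y
    proof (cases "x = y")
      case False
      then show ?thesis using *[rule_format, of "(x, y)"] that pos[OF False] by (simp add: divide_le_eq)
    qed (simp add: is_norm_zero[OF N])
  qed (use pos in \<open>auto simp: divide_le_eq\<close>)
  finally show ?thesis .
qed

text \<open>One inequality is the dual bound on the gradient of \<open>f\<close>. For the other, the
  essential supremum is itself an almost everywhere bound of \<open>g\<close>, so \<open>g\<close>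
  has a potential with that constant, and by uniqueness it is \<open>f\<close>.\<close>

lemma esssup_eq_lip_norm:
  assumes pot: "is_potential N U g f"
  shows "esssup (lebesgue_on U) (\<lambda>x. ereal (dual_norm N (g x))) = ereal (lip_norm N U f)"
proof -
  let ?M = "lebesgue_on U" and ?d = "\<lambda>x. ereal (dual_norm N (g x))"
  have f: "f \<in> Lip0_vectors N U" and g: "g \<in> Linf_fun N U" and compat: "lipschitz_compatible U g"
    using pot by (simp_all add: is_potential_def)
  have [measurable]: "g \<in> borel_measurable ?M" using g by (simp add: Linf_fun_def)
  note [measurable] = borel_measurable_dual_norm[OF N]
  have d_meas: "?d \<in> borel_measurable ?M" by measurable
  define L where "L = lip_norm N U f"
  have L: "0 \<le> L" "\<And>x y. x \<in> U \<Longrightarrow> y \<in> U \<Longrightarrow> \<bar>f x - f y\<bar> \<le> L * N (x - y)"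
    using lip_norm_le_iff[OF f, of L] by (simp_all add: L_def)
  obtain \<gamma> where \<gamma>: "is_gradient U f \<gamma>" "\<And>x v. \<bar>\<gamma> x \<bullet> v\<bar> \<le> L * N v"
    by (rule gradient_exists[OF L]) blast+
  have "AE x in ?M. ?d x \<le> ereal L"
    using gradient_AE_eq[OF pot \<gamma>(1)]
    by eventually_elim (use \<gamma>(2) L(1) in \<open>simp add: dual_norm_le_iff[OF N]\<close>)
  then have le: "esssup ?M ?d \<le> ereal L" by (rule esssup_I[OF d_meas])
  \<comment> \<open>Together with the upper bound this makes the essential supremum a nonnegative
    real, as \<open>potential_exists\<close> needs. It holds because a nonempty open set is not
    null.\<close>
  have nonneg: "0 \<le> esssup ?M ?d"
  proof (rule ccontr)
    assume neg: "\<not> 0 \<le> esssup ?M ?d"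
    have "AE x in lborel. x \<in> U \<longrightarrow> ?d x \<le> esssup ?M ?d"
      using esssup_AE[where M="?M" and f="?d"] by (simp add: AE_lebesgue_on_iff[OF domain_borel])
    then obtain x where "?d x \<le> esssup ?M ?d"
      using AE_lborel_open_ex[OF _ U(1)] U(3) by blast
    then have "?d x < 0" using neg by (meson le_less_trans not_le)
    then have "dual_norm N (g x) < 0" by simp
    then show False using dual_norm_le_iff[OF N, of "g x" "dual_norm N (g x)"] by simp
  qed
  obtain C where C: "esssup ?M ?d = ereal C" "0 \<le> C"
    using le nonneg by (cases "esssup ?M ?d") auto
  have "AE x in ?M. dual_norm N (g x) \<le> C" using esssup_AE[where M="?M" and f="?d"] by (simp add: C(1))
  then obtain f' where f': "is_potential N U g f'" "\<And>x y. x \<in> U \<Longrightarrow> y \<in> U \<Longrightarrow> \<bar>f' x - f' y\<bar> \<le> C * N (x - y)"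
    using potential_exists[OF C(2) g _ compat] by blast
  have "f' = f" by (rule potential_unique[OF f'(1) pot])
  then have "L \<le> C" using lip_norm_le_iff[OF f, of C] f'(2) C(2) by (simp add: L_def)
  then show ?thesis using le C(1) by (simp add: L_def)
qed

section \<open>Passage to equivalence classes\<close>

lemma equiv_Linf_rel: "equiv (Linf_fun N U) (Linf_rel N U)"
proof (rule equivI)
  show "Linf_rel N U \<subseteq> Linf_fun N U \<times> Linf_fun N U" by (auto simp: Linf_rel_def)
  show "refl_on (Linf_fun N U) (Linf_rel N U)" by (auto simp: refl_on_def Linf_rel_def)
  show "sym (Linf_rel N U)" by (auto simp: sym_def Linf_rel_def eq_commute)
  show "trans (Linf_rel N U)"
    by (auto simp: trans_def Linf_rel_def elim: eventually_elim2)
qed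

lemma linearly_isometric_Linf_compatible_Lip0:
  "linearly_isometric (Linf_compatible N U) (Lip0 N U)"
proof -
  let ?R = "Linf_rel N U" and ?X = "vectors (Linf_compatible N U)"
  have X: "?X = {G \<in> Linf_fun N U // ?R. \<forall>g\<in>G. lipschitz_compatible U g}"
    by (simp add: Linf_compatible_def Linf_def)
  \<comment> \<open>The potential chosen is common to all members of the class; existence follows
    from \<open>potential_exists\<close> and \<open>potential_AE_cong\<close>.\<close>
  define \<Phi> where "\<Phi> G = (SOME f. \<forall>g\<in>G. is_potential N U g f)" for G
  have class_potential: "is_potential N U g' f"
    if "G \<in> Linf_fun N U // ?R" "g \<in> G" "g' \<in> G" "is_potential N U g f" for G g g' f
  proof -
    have "(g, g') \<in> ?R" using quotient_eq_iff[OF equiv_Linf_rel that(1,1,2,3)] by simp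
    then show ?thesis using potential_AE_cong[OF that(4)] by (simp add: Linf_rel_def)
  qed
  have X_ex: "\<exists>g. g \<in> G" if "G \<in> ?X" for G
    using that in_quotient_imp_non_empty[OF equiv_Linf_rel, of G] by (auto simp: X)
  have \<Phi>: "is_potential N U g (\<Phi> G)" if G: "G \<in> ?X" and g: "g \<in> G" for G g
  proof -
    have gL: "g \<in> Linf_fun N U" and comp: "lipschitz_compatible U g" and Gq: "G \<in> Linf_fun N U // ?R"
      using G g in_quotient_imp_subset[OF equiv_Linf_rel, of G] by (auto simp: X)
    obtain C where C: "0 \<le> C" "AE x in lebesgue_on U. dual_norm N (g x) \<le> C"
      by (rule Linf_fun_bound[OF gL]) blast
    obtain f where "is_potential N U g f" by (rule potential_exists[OF C(1) gL C(2) comp]) blast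
    then have "\<forall>g\<in>G. is_potential N U g f" using class_potential[OF Gq g] by blast
    then have "\<forall>g\<in>G. is_potential N U g (\<Phi> G)" unfolding \<Phi>_def
      by (rule someI[where P="\<lambda>f. \<forall>g\<in>G. is_potential N U g f"])
    then show ?thesis using g by blast
  qed
  have class_X: "?R `` {g} \<in> ?X" "\<Phi> (?R `` {g}) = f" if pot: "is_potential N U g f" for g f
  proof -
    have gL: "g \<in> Linf_fun N U" using pot by (simp add: is_potential_def)
    have q: "?R `` {g} \<in> Linf_fun N U // ?R" by (rule quotientI[OF gL])
    have self: "g \<in> ?R `` {g}" by (rule equiv_class_self[OF equiv_Linf_rel gL])
    show X': "?R `` {g} \<in> ?X"
      unfolding X using q class_potential[OF q self _ pot] by (auto simp: is_potential_def)
    show "\<Phi> (?R `` {g}) = f" by (rule potential_unique[OF \<Phi>[OF X' self] pot])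
  qed
  have X_class: "G = ?R `` {g}" if "G \<in> ?X" "g \<in> G" for G g
  proof -
    have "G \<in> Linf_fun N U // ?R" using that(1) by (simp add: X)
    then obtain x where "G = ?R `` {x}" by (rule quotientE)
    then show ?thesis using that(2) equiv_class_eq[OF equiv_Linf_rel, of x g] by simp
  qed
  have bij: "bij_betw \<Phi> ?X (vectors (Lip0 N U))"
    unfolding bij_betw_def
  proof
    show "inj_on \<Phi> ?X"
    proof (rule inj_onI)
      fix G H assume GH: "G \<in> ?X" "H \<in> ?X" "\<Phi> G = \<Phi> H"
      obtain g h where gh: "g \<in> G" "h \<in> H" using X_ex GH by blast
      have pg: "is_potential N U g (\<Phi> G)" and ph: "is_potential N U h (\<Phi> G)"
        using \<Phi>[OF GH(1) gh(1)] \<Phi>[OF GH(2) gh(2)] GH(3) by simp_all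
      then have "(g, h) \<in> ?R"
        using potential_AE_unique[OF pg ph] by (simp add: Linf_rel_def is_potential_def)
      then show "G = H"
        using X_class[OF GH(1) gh(1)] X_class[OF GH(2) gh(2)] equiv_class_eq[OF equiv_Linf_rel] by simp
    qed
    show "\<Phi> ` ?X = vectors (Lip0 N U)"
    proof
      show "\<Phi> ` ?X \<subseteq> vectors (Lip0 N U)"
        using X_ex \<Phi> by (fastforce simp: Lip0_def is_potential_def)
      show "vectors (Lip0 N U) \<subseteq> \<Phi> ` ?X"
      proof
        fix f assume "f \<in> vectors (Lip0 N U)"
        then have "f \<in> Lip0_vectors N U" by (simp add: Lip0_def)
        then obtain g where "is_potential N U g f" by (rule potential_surj)
        from class_X[OF this] show "f \<in> \<Phi> ` ?X" by blast
      qed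
    qed
  qed
  have add: "vadd (Linf_compatible N U) G H \<in> ?X \<and>
      \<Phi> (vadd (Linf_compatible N U) G H) = vadd (Lip0 N U) (\<Phi> G) (\<Phi> H)" if GH: "G \<in> ?X" "H \<in> ?X" for G H
  proof -
    let ?f = "\<lambda>x\<in>U. \<Phi> G x + \<Phi> H x"
    obtain g0 h0 where gh: "g0 \<in> G" "h0 \<in> H" using X_ex GH by blast
    have pot: "is_potential N U (\<lambda>x. g x + h x) ?f" if "g \<in> G" "h \<in> H" for g h
      using potential_add[OF \<Phi>[OF GH(1) that(1)] \<Phi>[OF GH(2) that(2)]] .
    \<comment> \<open>The sum of classes is a union over all pairs of representatives. The classes
      in it coincide, because all these sums have the same potential.\<close>
    have eq: "?R `` {\<lambda>x. g x + h x} = ?R `` {\<lambda>x. g0 x + h0 x}" if "g \<in> G" "h \<in> H" for g h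
      using potential_AE_unique[OF pot[OF that] pot[OF gh]] pot[OF that] pot[OF gh]
      by (intro equiv_class_eq[OF equiv_Linf_rel]) (simp add: Linf_rel_def is_potential_def)
    have "vadd (Linf_compatible N U) G H = (\<Union>g\<in>G. \<Union>h\<in>H. ?R `` {\<lambda>x. g x + h x})"
      by (simp add: Linf_compatible_def Linf_def)
    also have "\<dots> = (\<Union>g\<in>G. \<Union>h\<in>H. ?R `` {\<lambda>x. g0 x + h0 x})"
      by (intro SUP_cong refl eq)
    also have "\<dots> = ?R `` {\<lambda>x. g0 x + h0 x}" using gh by blast
    finally show ?thesis using class_X[OF pot[OF gh]] by (simp add: Lip0_def)
  qed
  have scale: "vscale (Linf_compatible N U) c G \<in> ?X \<and>
      \<Phi> (vscale (Linf_compatible N U) c G) = vscale (Lip0 N U) c (\<Phi> G)" if G: "G \<in> ?X" for c G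
  proof -
    let ?f = "\<lambda>x\<in>U. c * \<Phi> G x"
    obtain g0 where g0: "g0 \<in> G" using X_ex G by blast
    have pot: "is_potential N U (\<lambda>x. c *\<^sub>R g x) ?f" if "g \<in> G" for g
      using potential_scale[OF \<Phi>[OF G that]] .
    have eq: "?R `` {\<lambda>x. c *\<^sub>R g x} = ?R `` {\<lambda>x. c *\<^sub>R g0 x}" if "g \<in> G" for g
      using potential_AE_unique[OF pot[OF that] pot[OF g0]] pot[OF that] pot[OF g0]
      by (intro equiv_class_eq[OF equiv_Linf_rel]) (simp add: Linf_rel_def is_potential_def)
    have "vscale (Linf_compatible N U) c G = (\<Union>g\<in>G. ?R `` {\<lambda>x. c *\<^sub>R g x})"
      by (simp add: Linf_compatible_def Linf_def)
    also have "\<dots> = (\<Union>g\<in>G. ?R `` {\<lambda>x. c *\<^sub>R g0 x})"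
      by (intro SUP_cong refl eq)
    also have "\<dots> = ?R `` {\<lambda>x. c *\<^sub>R g0 x}" using g0 by blast
    finally show ?thesis using class_X[OF pot[OF g0]] by (simp add: Lip0_def)
  qed
  have norm: "vnorm (Lip0 N U) (\<Phi> G) = vnorm (Linf_compatible N U) G" if G: "G \<in> ?X" for G
  proof -
    \<comment> \<open>All members of the class share the potential \<open>\<Phi> G\<close>, so the
      image is a singleton and \<open>the_elem\<close> returns its element.\<close>
    have "(\<lambda>g. esssup (lebesgue_on U) (\<lambda>x. ereal (dual_norm N (g x)))) ` G = {ereal (lip_norm N U (\<Phi> G))}"
      using esssup_eq_lip_norm[OF \<Phi>[OF G]] X_ex[OF G] by (auto simp: image_iff)
    then show ?thesis by (simp add: Lip0_def Linf_compatible_def Linf_def)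
  qed
  show ?thesis
    unfolding linearly_isometric_def using bij add scale norm by (intro exI[of _ \<Phi>]) blast
qed

end

theorem theorem21:
  fixes N :: "real ^ 'n \<Rightarrow> real" and U :: "(real ^ 'n) set"
  assumes "is_norm N"
    and "U \<noteq> {}" and "open U" and "convex U" and "0 \<in> U"
  shows "linearly_isometric (Linf_compatible N U) (Lip0 N U)"
  using assms(1,3,4,5) by (rule linearly_isometric_Linf_compatible_Lip0)

end
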